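(* Let $d\ge2$, let $\Omega\subset\mathbb C^d$ be a bounded domain, and let $H_{\mathfrak K}$ be a reproducing kernel Hilbert space of holomorphic functions on $\Omega$ with kernel $\mathfrak K$. Assume that $\mathcal P_d=\mathbb C[z_1,\dots,z_d]$ is (contained and) dense in $H_{\mathfrak K}$, that the coordinate multipliers $M_{z_1},\dots,M_{z_d}$ are bounded on $H_{\mathfrak K}$, and that $\mathfrak K(\lambda,\lambda)\to\infty$ as $\lambda\to\partial\Omega$. Let $N\ge1$ and let $\mathcal M_1,\mathcal M_2\subset H_{\mathfrak K}\otimes\mathbb C^N$ be finite-codimensional submodules. Suppose there exists a unitary module isomorphism $U:\mathcal M_1\to\mathcal M_2$, i.e. $U$ is unitary and $$U\bigl(M_{z_j}\otimes I|_{\mathcal M_1}\bigr)=\bigl(M_{z_j}\otimes I|_{\mathcal M_2}\bigr)U,\qquad j=1,\dots,d.$$ Then there exists a constant unitary matrix $W\in M_N(\mathbb C)$ such that $\mathcal M_2=(I_{H_{\mathfrak K}}\otimes W)\mathcal M_1$. In particular, for $N=1$, $\mathcal M_1$ is unitarily equivalent to $\mathcal M_2$ (i.e. such a $U$ exists) if and only if $\mathcal M_1=\mathcal M_2$.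
   Context: A submodule of $H_{\mathfrak K}\otimes\mathbb C^N$ is a closed subspace invariant under $M_{z_j}\otimes I$ for $j=1,\dots,d$. Finite-codimensional means finite codimension in $H_{\mathfrak K}\otimes\mathbb C^N$. *)

theory Defs
  imports "HOL-Analysis.Analysis" "HOL-Library.Function_Algebras"
begin

section \<open>Complex inner product spaces carried by a set of functions\<close>

definition cscale :: "complex \<Rightarrow> ('a \<Rightarrow> complex) \<Rightarrow> 'a \<Rightarrow> complex"
  where "cscale c f = (\<lambda>z. c * f z)"

definition vscale :: "complex \<Rightarrow> ('a \<Rightarrow> complex ^ 'n) \<Rightarrow> 'a \<Rightarrow> complex ^ 'n"
  where "vscale c F = (\<lambda>z. c *s F z)"

global_interpretation cfun: vector_space cscale
  by standard (auto simp: cscale_def fun_eq_iff algebra_simps)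

global_interpretation vfun: vector_space vscale
  by standard (auto simp: vscale_def fun_eq_iff vec_eq_iff algebra_simps)

text \<open>Linear in the first argument. Hermitian symmetry makes \<open>ip f f\<close> real.\<close>

definition inner_product_on ::
  "(complex \<Rightarrow> 'v \<Rightarrow> 'v) \<Rightarrow> 'v::ab_group_add set \<Rightarrow> ('v \<Rightarrow> 'v \<Rightarrow> complex) \<Rightarrow> bool"
  where "inner_product_on smul S ip \<longleftrightarrow>
    (\<forall>f\<in>S. \<forall>g\<in>S. \<forall>h\<in>S. ip (f + g) h = ip f h + ip g h) \<and>
    (\<forall>c. \<forall>f\<in>S. \<forall>g\<in>S. ip (smul c f) g = c * ip f g) \<and>
    (\<forall>f\<in>S. \<forall>g\<in>S. ip g f = cnj (ip f g)) \<and>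
    (\<forall>f\<in>S. f \<noteq> 0 \<longrightarrow> 0 < Re (ip f f))"

definition ip_norm :: "('v \<Rightarrow> 'v \<Rightarrow> complex) \<Rightarrow> 'v \<Rightarrow> real"
  where "ip_norm ip f = sqrt (Re (ip f f))"

text \<open>The value off the carrier is immaterial, but \<^locale>\<open>Metric_space\<close> wants a
  nonnegative and symmetric distance there as well.\<close>

definition ip_dist :: "'v::ab_group_add set \<Rightarrow> ('v \<Rightarrow> 'v \<Rightarrow> complex) \<Rightarrow> 'v \<Rightarrow> 'v \<Rightarrow> real"
  where "ip_dist S ip f g = (if f \<in> S \<and> g \<in> S then ip_norm ip (f - g) else 0)"

definition hilbert_space_on ::
  "(complex \<Rightarrow> 'v \<Rightarrow> 'v) \<Rightarrow> 'v::ab_group_add set \<Rightarrow> ('v \<Rightarrow> 'v \<Rightarrow> complex) \<Rightarrow> bool"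
  where "hilbert_space_on smul S ip \<longleftrightarrow>
    module.subspace smul S \<and> inner_product_on smul S ip \<and>
    Metric_space.mcomplete S (ip_dist S ip)"

abbreviation ip_topology ::
  "'v::ab_group_add set \<Rightarrow> ('v \<Rightarrow> 'v \<Rightarrow> complex) \<Rightarrow> 'v topology"
  where "ip_topology S ip \<equiv> Metric_space.mtopology S (ip_dist S ip)"


section \<open>Reproducing kernel Hilbert spaces of holomorphic functions\<close>

text \<open>A function on \<open>\<Omega>\<close> is represented by its extension by zero, so that equality of
  functions on \<open>\<Omega>\<close> is equality of the representatives.\<close>

definition zero_ext :: "'a set \<Rightarrow> ('a \<Rightarrow> complex) \<Rightarrow> 'a \<Rightarrow> complex"
  where "zero_ext \<Omega> f = (\<lambda>z. if z \<in> \<Omega> then f z else 0)"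

text \<open>Several complex variables: the real Frechet derivative is complex linear.\<close>

definition holomorphic_Cn_on :: "(complex ^ 'd \<Rightarrow> complex) \<Rightarrow> (complex ^ 'd) set \<Rightarrow> bool"
  where "holomorphic_Cn_on f \<Omega> \<longleftrightarrow>
    (\<forall>z\<in>\<Omega>. \<exists>D. (f has_derivative D) (at z) \<and> (\<forall>c v. D (c *s v) = c * D v))"

text \<open>Here \<open>\<KK> z w\<close> is the kernel, and \<open>\<KK> \<cdot> w\<close> represents evaluation at \<open>w\<close>.\<close>

locale holomorphic_rkhs =
  fixes \<Omega> :: "(complex ^ 'd) set"
    and H :: "(complex ^ 'd \<Rightarrow> complex) set"
    and ip :: "(complex ^ 'd \<Rightarrow> complex) \<Rightarrow> (complex ^ 'd \<Rightarrow> complex) \<Rightarrow> complex"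
    and \<KK> :: "complex ^ 'd \<Rightarrow> complex ^ 'd \<Rightarrow> complex"
  assumes hilbert: "hilbert_space_on cscale H ip"
    and zero_outside: "f \<in> H \<Longrightarrow> z \<notin> \<Omega> \<Longrightarrow> f z = 0"
    and holomorphic: "f \<in> H \<Longrightarrow> holomorphic_Cn_on f \<Omega>"
    and kernel_mem: "w \<in> \<Omega> \<Longrightarrow> zero_ext \<Omega> (\<lambda>z. \<KK> z w) \<in> H"
    and reproducing: "f \<in> H \<Longrightarrow> w \<in> \<Omega> \<Longrightarrow> f w = ip f (zero_ext \<Omega> (\<lambda>z. \<KK> z w))"

definition polynomials :: "(complex ^ 'd) set \<Rightarrow> (complex ^ 'd \<Rightarrow> complex) set"
  where "polynomials \<Omega> =
    cfun.span (range (\<lambda>\<alpha> :: 'd \<Rightarrow> nat. zero_ext \<Omega> (\<lambda>z. \<Prod>j\<in>UNIV. z $ j ^ \<alpha> j)))"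

definition coord_mult :: "'d \<Rightarrow> (complex ^ 'd \<Rightarrow> complex) \<Rightarrow> complex ^ 'd \<Rightarrow> complex"
  where "coord_mult j f = (\<lambda>z. z $ j * f z)"

definition bounded_on ::
  "'v set \<Rightarrow> ('v \<Rightarrow> 'v \<Rightarrow> complex) \<Rightarrow> ('v \<Rightarrow> 'v) \<Rightarrow> bool"
  where "bounded_on S ip T \<longleftrightarrow>
    T ` S \<subseteq> S \<and> (\<exists>C. \<forall>f\<in>S. ip_norm ip (T f) \<le> C * ip_norm ip f)"

definition tends_to_infinity_at_boundary :: "'a::metric_space set \<Rightarrow> ('a \<Rightarrow> real) \<Rightarrow> bool"
  where "tends_to_infinity_at_boundary \<Omega> u \<longleftrightarrow>
    (\<forall>R. \<exists>\<delta>>0. \<forall>z\<in>\<Omega>. infdist z (frontier \<Omega>) < \<delta> \<longrightarrow> R < u z)"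


section \<open>The tensor product with a coordinate space, and its submodules\<close>

text \<open>The Hilbert space tensor product of \<open>H\<close> with \<open>complex ^ 'n\<close> is realised as the
  space of vector-valued functions with all components in \<open>H\<close>; the elementary tensor
  of \<open>f\<close> and \<open>v\<close> is \<open>\<lambda>z. f z *s v\<close>. Because the second factor is finite-dimensional,
  the algebraic tensor product is already complete.\<close>

definition elem_tensor :: "('a \<Rightarrow> complex) \<Rightarrow> complex ^ 'n \<Rightarrow> 'a \<Rightarrow> complex ^ 'n"
  where "elem_tensor f v = (\<lambda>z. f z *s v)"

definition tensor_Cn :: "('a \<Rightarrow> complex) set \<Rightarrow> ('a \<Rightarrow> complex ^ 'n) set"
  where "tensor_Cn H = {F. \<forall>i. (\<lambda>z. F z $ i) \<in> H}"

definition tensor_ip :: "(('a \<Rightarrow> complex) \<Rightarrow> ('a \<Rightarrow> complex) \<Rightarrow> complex) \<Rightarrow>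
    ('a \<Rightarrow> complex ^ 'n) \<Rightarrow> ('a \<Rightarrow> complex ^ 'n) \<Rightarrow> complex"
  where "tensor_ip ip F G = (\<Sum>i\<in>UNIV. ip (\<lambda>z. F z $ i) (\<lambda>z. G z $ i))"

text \<open>The operators \<open>M\<^sub>z\<^sub>j \<otimes> I\<close> and \<open>I \<otimes> W\<close>.\<close>

definition coord_mult_tensor ::
  "'d \<Rightarrow> (complex ^ 'd \<Rightarrow> complex ^ 'n) \<Rightarrow> complex ^ 'd \<Rightarrow> complex ^ 'n"
  where "coord_mult_tensor j F = (\<lambda>z. z $ j *s F z)"

definition matrix_tensor ::
  "complex ^ 'n ^ 'n \<Rightarrow> ('a \<Rightarrow> complex ^ 'n) \<Rightarrow> 'a \<Rightarrow> complex ^ 'n"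
  where "matrix_tensor W F = (\<lambda>z. W *v F z)"

definition conj_transpose :: "complex ^ 'n ^ 'm \<Rightarrow> complex ^ 'm ^ 'n"
  where "conj_transpose A = (\<chi> i j. cnj (A $ j $ i))"

definition unitary_matrix :: "complex ^ 'n ^ 'n \<Rightarrow> bool"
  where "unitary_matrix W \<longleftrightarrow>
    conj_transpose W ** W = mat 1 \<and> W ** conj_transpose W = mat 1"

definition submodule ::
  "(complex ^ 'd \<Rightarrow> complex) set \<Rightarrow>
   ((complex ^ 'd \<Rightarrow> complex) \<Rightarrow> (complex ^ 'd \<Rightarrow> complex) \<Rightarrow> complex) \<Rightarrow>
   (complex ^ 'd \<Rightarrow> complex ^ 'n) set \<Rightarrow> bool"
  where "submodule H ip M \<longleftrightarrow>
    vfun.subspace M \<and>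
    closedin (ip_topology (tensor_Cn H) (tensor_ip ip)) M \<and>
    (\<forall>j. coord_mult_tensor j ` M \<subseteq> M)"

text \<open>\<open>tensor_Cn H\<close> is spanned by \<open>M\<close> together with finitely many further elements.\<close>

definition finite_codim ::
  "('a \<Rightarrow> complex) set \<Rightarrow> ('a \<Rightarrow> complex ^ 'n) set \<Rightarrow> bool"
  where "finite_codim H M \<longleftrightarrow> M \<subseteq> tensor_Cn H \<and>
    (\<exists>B. finite B \<and> B \<subseteq> tensor_Cn H \<and>
      (\<forall>F\<in>tensor_Cn H. \<exists>G\<in>M. F - G \<in> vfun.span B))"

definition unitary_module_iso ::
  "((complex ^ 'd \<Rightarrow> complex) \<Rightarrow> (complex ^ 'd \<Rightarrow> complex) \<Rightarrow> complex) \<Rightarrow>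
   (complex ^ 'd \<Rightarrow> complex ^ 'n) set \<Rightarrow> (complex ^ 'd \<Rightarrow> complex ^ 'n) set \<Rightarrow>
   ((complex ^ 'd \<Rightarrow> complex ^ 'n) \<Rightarrow> (complex ^ 'd \<Rightarrow> complex ^ 'n)) \<Rightarrow> bool"
  where "unitary_module_iso ip M1 M2 U \<longleftrightarrow>
    bij_betw U M1 M2 \<and>
    (\<forall>F\<in>M1. \<forall>G\<in>M1. U (F + G) = U F + U G) \<and>
    (\<forall>c. \<forall>F\<in>M1. U (vscale c F) = vscale c (U F)) \<and>
    (\<forall>F\<in>M1. \<forall>G\<in>M1. tensor_ip ip (U F) (U G) = tensor_ip ip F G) \<and>
    (\<forall>j. \<forall>F\<in>M1. U (coord_mult_tensor j F) = coord_mult_tensor j (U F))"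


section \<open>Consistency of the encodings\<close>

lemma inner_product_onD:
  assumes "inner_product_on smul S ip"
  shows ip_add: "f \<in> S \<Longrightarrow> g \<in> S \<Longrightarrow> h \<in> S \<Longrightarrow> ip (f + g) h = ip f h + ip g h"
    and ip_smul: "f \<in> S \<Longrightarrow> g \<in> S \<Longrightarrow> ip (smul c f) g = c * ip f g"
    and ip_sym: "f \<in> S \<Longrightarrow> g \<in> S \<Longrightarrow> ip g f = cnj (ip f g)"
    and ip_pos: "f \<in> S \<Longrightarrow> f \<noteq> 0 \<Longrightarrow> 0 < Re (ip f f)"
proof -
  note ip = assms[unfolded inner_product_on_def]
  show "f \<in> S \<Longrightarrow> g \<in> S \<Longrightarrow> h \<in> S \<Longrightarrow> ip (f + g) h = ip f h + ip g h"
    by (rule ip[THEN conjunct1, rule_format])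
  show "f \<in> S \<Longrightarrow> g \<in> S \<Longrightarrow> ip (smul c f) g = c * ip f g"
    by (rule ip[THEN conjunct2, THEN conjunct1, rule_format])
  show "f \<in> S \<Longrightarrow> g \<in> S \<Longrightarrow> ip g f = cnj (ip f g)"
    by (rule ip[THEN conjunct2, THEN conjunct2, THEN conjunct1, rule_format])
  show "f \<in> S \<Longrightarrow> f \<noteq> 0 \<Longrightarrow> 0 < Re (ip f f)"
    by (rule ip[THEN conjunct2, THEN conjunct2, THEN conjunct2, rule_format])
qed

lemma Metric_space_ip_dist:
  assumes vs: "vector_space smul" and S: "module.subspace smul S"
    and ip: "inner_product_on smul S ip"
  shows "Metric_space S (ip_dist S ip)"
proof -
  interpret vector_space smul by (rule vs)
  note add = ip_add[OF ip] and sc = ip_smul[OF ip] and sym = ip_sym[OF ip]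
    and pos = ip_pos[OF ip]
  have mem: "0 \<in> S" "f \<in> S \<Longrightarrow> g \<in> S \<Longrightarrow> f + g \<in> S" "f \<in> S \<Longrightarrow> smul c f \<in> S"
    "f \<in> S \<Longrightarrow> g \<in> S \<Longrightarrow> f - g \<in> S" for f g c
    using subspace_0[OF S] subspace_add[OF S] subspace_scale[OF S] subspace_diff[OF S] by auto
  have ip0: "ip 0 0 = 0" using sc[of 0 0 0] mem by simp
  have nonneg: "0 \<le> Re (ip f f)" if "f \<in> S" for f
    using pos[OF that] ip0 by (cases "f = 0") auto
  have expand: "Re (ip (f + smul (of_real t) g) (f + smul (of_real t) g))
      = Re (ip f f) + 2 * t * Re (ip f g) + t\<^sup>2 * Re (ip g g)"
    if f: "f \<in> S" and g: "g \<in> S" for f g t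
  proof -
    let ?h = "smul (of_real t) g"
    have h: "?h \<in> S" using g by (rule mem)
    have 3: "ip ?h f = t * ip g f" and 4: "ip ?h ?h = t * ip g ?h"
      by (rule sc[OF g f] sc[OF g h])+
    have 1: "ip f ?h = t * ip f g"
      unfolding sym[OF h f] 3 sym[OF f g] by simp
    have 2: "ip ?h ?h = t * (t * cnj (ip g g))"
      unfolding 4 sym[OF h g] sc[OF g g] by simp
    have "ip (f + ?h) (f + ?h) = ip f (f + ?h) + ip ?h (f + ?h)"
      using f h mem by (intro add) auto
    moreover have "ip f (f + ?h) = cnj (ip f f) + cnj (ip ?h f)"
      unfolding sym[OF mem(2)[OF f h] f] add[OF f h f] by simp
    moreover have "ip ?h (f + ?h) = cnj (ip f ?h) + cnj (ip ?h ?h)"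
      unfolding sym[OF mem(2)[OF f h] h] add[OF f h h] by simp
    moreover have "Re (ip g f) = Re (ip f g)"
      unfolding sym[OF f g] by simp
    ultimately show ?thesis
      by (simp only: 1 2 3) (simp add: power2_eq_square)
  qed
  have cs: "Re (ip f g) \<le> ip_norm ip f * ip_norm ip g" if f: "f \<in> S" and g: "g \<in> S" for f g
  proof (cases "g = 0")
    case True
    have "ip 0 f = 0" using sc[of 0 f 0] mem f by simp
    then have "ip f 0 = 0" using sym[OF mem(1) f] by simp
    then show ?thesis using True ip0 by (simp add: ip_norm_def)
  next
    case False
    let ?a = "Re (ip f f)" and ?b = "Re (ip f g)" and ?c = "Re (ip g g)"
    have c: "?c > 0" using pos g False by blast
    have "0 \<le> ?a + 2 * (- ?b / ?c) * ?b + (- ?b / ?c)\<^sup>2 * ?c"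
      using expand[OF f g, of "- ?b / ?c"] nonneg f g mem by metis
    also have "\<dots> = ?a - ?b\<^sup>2 / ?c"
      using c by (simp add: field_simps power2_eq_square)
    finally have "?b\<^sup>2 \<le> ?a * ?c"
      using c by (simp add: field_simps)
    then have "\<bar>?b\<bar> \<le> sqrt (?a * ?c)"
      by (simp add: real_le_rsqrt)
    then show ?thesis by (simp add: ip_norm_def real_sqrt_mult)
  qed
  have tri: "ip_norm ip (f + g) \<le> ip_norm ip f + ip_norm ip g" if f: "f \<in> S" and g: "g \<in> S" for f g
  proof -
    have "Re (ip (f + g) (f + g)) = Re (ip f f) + 2 * Re (ip f g) + Re (ip g g)"
      using expand[OF f g, of 1] by simp
    also have "\<dots> \<le> (ip_norm ip f + ip_norm ip g)\<^sup>2"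
      using cs[OF f g] nonneg f g by (simp add: power2_sum ip_norm_def)
    finally show ?thesis
      using nonneg f g by (simp add: ip_norm_def[of _ "f + g"] real_le_lsqrt ip_norm_def)
  qed
  have neg: "ip_norm ip (- f) = ip_norm ip f" if f: "f \<in> S" for f
  proof -
    have "ip 0 f = 0" using sc[of 0 f 0] f mem by simp
    then show ?thesis
      using expand[OF mem(1) f, of "-1"] ip0 by (simp add: ip_norm_def)
  qed
  show ?thesis
  proof
    fix x y z
    show "0 \<le> ip_dist S ip x y"
      using nonneg mem by (simp add: ip_dist_def ip_norm_def)
    have "ip_norm ip (x - y) = ip_norm ip (y - x)" if "x \<in> S" "y \<in> S"
      using neg[OF mem(4)[OF that]] by simp
    then show "ip_dist S ip x y = ip_dist S ip y x"
      by (simp add: ip_dist_def)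
    assume x: "x \<in> S" and y: "y \<in> S"
    have "ip_norm ip (x - y) = 0 \<longleftrightarrow> x = y"
    proof (cases "x = y")
      case False
      then show ?thesis using pos[OF mem(4)[OF x y]] by (simp add: ip_norm_def)
    qed (simp add: ip_norm_def ip0)
    then show "ip_dist S ip x y = 0 \<longleftrightarrow> x = y"
      using x y by (simp add: ip_dist_def)
    assume z: "z \<in> S"
    show "ip_dist S ip x z \<le> ip_dist S ip x y + ip_dist S ip y z"
      using tri[OF mem(4)[OF x y] mem(4)[OF y z]] x y z by (simp add: ip_dist_def)
  qed
qed

lemma inner_product_on_tensor:
  assumes "inner_product_on cscale H ip" "cfun.subspace H"
  shows "inner_product_on vscale (tensor_Cn H :: ('a \<Rightarrow> complex ^ 'n) set) (tensor_ip ip)"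
proof -
  note add = ip_add[OF assms(1)] and sc = ip_smul[OF assms(1)] and sym = ip_sym[OF assms(1)]
    and pos = ip_pos[OF assms(1)]
  have "0 \<in> H" using assms(2) by (rule cfun.subspace_0)
  then have "ip 0 0 = 0" using sc[of 0 0 0] by (simp add: cscale_def zero_fun_def)
  then have nonneg: "0 \<le> Re (ip f f)" if "f \<in> H" for f
    using pos[OF that] by (cases "f = 0") auto
  show ?thesis
    unfolding inner_product_on_def
  proof (intro conjI ballI allI impI)
    fix F G K :: "'a \<Rightarrow> complex ^ 'n" and c
    assume F: "F \<in> tensor_Cn H" and G: "G \<in> tensor_Cn H"
    have mem: "(\<lambda>z. F z $ i) \<in> H" "(\<lambda>z. G z $ i) \<in> H" for i
      using F G by (auto simp: tensor_Cn_def)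
    show "tensor_ip ip (vscale c F) G = c * tensor_ip ip F G"
      using sc[OF mem] by (simp add: tensor_ip_def vscale_def cscale_def sum_distrib_left)
    show "tensor_ip ip G F = cnj (tensor_ip ip F G)"
      using sym[OF mem] by (simp add: tensor_ip_def)
    assume K: "K \<in> tensor_Cn H"
    have memK: "(\<lambda>z. K z $ i) \<in> H" for i
      using K by (auto simp: tensor_Cn_def)
    show "tensor_ip ip (F + G) K = tensor_ip ip F K + tensor_ip ip G K"
      using add[OF mem memK] by (simp add: tensor_ip_def plus_fun_def sum.distrib)
  next
    fix F :: "'a \<Rightarrow> complex ^ 'n"
    assume F: "F \<in> tensor_Cn H" and "F \<noteq> 0"
    then obtain i where i: "(\<lambda>z. F z $ i) \<noteq> 0"
      by (auto simp: fun_eq_iff vec_eq_iff)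
    have mem: "(\<lambda>z. F z $ i) \<in> H" for i
      using F by (auto simp: tensor_Cn_def)
    show "0 < Re (tensor_ip ip F F)"
      unfolding tensor_ip_def Re_sum
      using pos[OF mem i] nonneg[OF mem] by (intro sum_pos2[where i = i]) auto
  qed
qed

lemma tensor_ip_elem_tensor:
  assumes ip: "inner_product_on cscale H ip" and H: "cfun.subspace H"
    and f: "f \<in> H" and g: "g \<in> H"
  shows "tensor_ip ip (elem_tensor f v) (elem_tensor g w) = ip f g * (\<Sum>i\<in>UNIV. v $ i * cnj (w $ i))"
proof -
  note sc = ip_smul[OF ip] and sym = ip_sym[OF ip]
  have mem: "cscale c h \<in> H" if "h \<in> H" for c h
    using H that by (rule cfun.subspace_scale)
  have "ip (cscale a f) (cscale b g) = a * cnj b * ip f g" for a b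
  proof -
    have "ip (cscale a f) (cscale b g) = a * ip f (cscale b g)"
      using f g by (simp add: sc mem)
    also have "ip f (cscale b g) = cnj (ip (cscale b g) f)"
      using f g mem by (intro sym)
    also have "\<dots> = cnj b * ip f g"
      using f g by (simp add: sc sym[of g f])
    finally show ?thesis by simp
  qed
  then have "ip (\<lambda>z. f z * a) (\<lambda>z. g z * b) = ip f g * (a * cnj b)" for a b
    by (simp add: cscale_def mult.commute)
  then show ?thesis
    by (simp add: tensor_ip_def elem_tensor_def sum_distrib_left)
qed

lemma tensor_Cn_eq_span:
  assumes H: "cfun.subspace H"
  shows "(tensor_Cn H :: ('a \<Rightarrow> complex ^ 'n) set) = vfun.span {elem_tensor f v | f v. f \<in> H}"
proof
  let ?E = "{elem_tensor f v | f (v :: complex ^ 'n). f \<in> H}"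
  show "tensor_Cn H \<subseteq> vfun.span ?E"
  proof
    fix F :: "'a \<Rightarrow> complex ^ 'n"
    assume F: "F \<in> tensor_Cn H"
    have comp: "(\<Sum>i\<in>I. elem_tensor (\<lambda>z. F z $ i) (axis i 1)) z
        = (\<Sum>i\<in>I. F z $ i *s axis i 1)" for z and I :: "'n set"
      by (induction I rule: infinite_finite_induct) (auto simp: elem_tensor_def)
    have "F = (\<Sum>i\<in>UNIV. elem_tensor (\<lambda>z. F z $ i) (axis i 1))"
      by (rule ext) (simp add: comp basis_expansion)
    also have "\<dots> \<in> vfun.span ?E"
      using F by (intro vfun.span_sum vfun.span_base) (auto simp: tensor_Cn_def)
    finally show "F \<in> vfun.span ?E" .
  qed
  have "vfun.subspace (tensor_Cn H :: ('a \<Rightarrow> complex ^ 'n) set)"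
    using cfun.subspace_0[OF H] cfun.subspace_add[OF H] cfun.subspace_scale[OF H]
    by (auto simp: vfun.subspace_def tensor_Cn_def vscale_def cscale_def
        zero_fun_def plus_fun_def)
  moreover have "(\<lambda>z. f z * a) \<in> H" if "f \<in> H" for f a
    using cfun.subspace_scale[OF H that, of a] by (simp add: cscale_def mult.commute[of a])
  then have "?E \<subseteq> tensor_Cn H"
    by (auto simp: tensor_Cn_def elem_tensor_def)
  ultimately show "vfun.span ?E \<subseteq> tensor_Cn H"
    by (intro vfun.span_minimal)
qed

end

theory Submission
  imports Defs "HOL-Complex_Analysis.Conformal_Mappings"
begin

text \<open>
  Write \<open>T\<close> for the tensor product of \<open>H\<close> with \<open>\<complex>\<^sup>N\<close> and \<open>k\<^sub>z\<close> for the kernel function at \<open>z\<close>.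

  \<^bold>\<open>\<open>U\<close> is a multiplication operator.\<close>  Multiplication by \<open>z\<^sub>j\<close> acts on the finite-dimensional
  quotient \<open>T / M\<^sub>1\<close>, so some nonzero polynomial \<open>p\<^sub>j\<close> in one variable satisfies
  \<open>p\<^sub>j(z\<^sub>j) T \<subseteq> M\<^sub>1\<close> (\<open>annihilating_poly\<close>).  Then \<open>F \<mapsto> U (p\<^sub>j(z\<^sub>j) F)\<close> is a bounded module map on all
  of \<open>T\<close>, and by density of the polynomials it is multiplication by a matrix-valued function
  (\<open>bounded_module_map_eq\<close>).  Dividing by \<open>p\<^sub>j(z\<^sub>j)\<close> shows that \<open>U\<close> is multiplication by a matrix
  function \<open>\<Phi>\<close> at every point where some \<open>p\<^sub>j(z\<^sub>j)\<close> does not vanish (\<open>exists_multiplier\<close>), that is,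
  outside a finite set.

  \<^bold>\<open>Boundary values.\<close>  Since \<open>\<parallel>k\<^sub>z\<parallel>\<^sup>2\<close> is the kernel on the diagonal, it blows up at the boundary,
  whereas polynomials stay bounded; so the normalised kernel functions tend weakly to zero.
  The distance to a closed subspace of finite codimension is governed by finitely many inner
  products (\<open>finite_codim_approx\<close>), hence the vectors \<open>k\<^sub>z \<otimes> v\<close> lie asymptotically in \<open>M\<^sub>1\<close>
  (\<open>kernel_near_M\<close>).  As \<open>U\<close> is isometric, this forces \<open>limsup \<parallel>\<Phi>(z)\<parallel> \<le> 1\<close> at the boundary
  (\<open>local_matrix_bound\<close>).

  \<^bold>\<open>Inside the domain.\<close>  This is where \<open>d \<ge> 2\<close> matters.  Through a point with \<open>p\<^sub>j(z\<^sub>j) \<noteq> 0\<close> there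
  is a complex line in the direction of another coordinate.  Along it \<open>p\<^sub>j(z\<^sub>j)\<close> is a nonzero
  constant, so \<open>\<Phi>\<close> is holomorphic on the slice, and the maximum principle in one variable yields
  \<open>\<parallel>\<Phi>(z)\<parallel> \<le> 1\<close> (\<open>multiplier_contraction\<close>).

  \<^bold>\<open>Rigidity.\<close>  The same holds for the inverse of \<open>U\<close>, whose multiplier inverts \<open>\<Phi>\<close>; so \<open>\<Phi>(z)\<close> is
  unitary outside a finite set.  The equality case of the maximum principle makes \<open>\<Phi>\<close> locally
  constant there, and a domain minus a finite set is connected (\<open>multiplier_constant\<close>).  The
  constant value \<open>W\<close> satisfies \<open>U F = W F\<close> on all of \<open>\<Omega>\<close> by continuity.  For \<open>N = 1\<close> the matrix
  \<open>W\<close> is a nonzero scalar, and a subspace is mapped onto itself by it.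
\<close>

section \<open>Hilbert spaces on a carrier set\<close>

locale hilbert_carrier = vector_space smul
  for smul :: "complex \<Rightarrow> 'v \<Rightarrow> 'v::ab_group_add" +
  fixes S :: "'v set" and ip :: "'v \<Rightarrow> 'v \<Rightarrow> complex"
  assumes hilbert: "hilbert_space_on smul S ip"
begin

abbreviation nrm :: "'v \<Rightarrow> real" where "nrm \<equiv> ip_norm ip"

lemma subspace_S: "subspace S" and inner_S: "inner_product_on smul S ip"
  using hilbert by (auto simp: hilbert_space_on_def)

lemma S_mem [simp]: "0 \<in> S" "f \<in> S \<Longrightarrow> g \<in> S \<Longrightarrow> f + g \<in> S" "f \<in> S \<Longrightarrow> smul c f \<in> S"
    "f \<in> S \<Longrightarrow> g \<in> S \<Longrightarrow> f - g \<in> S"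
  using subspace_S subspace_0 subspace_add subspace_scale subspace_diff by blast+

lemma S_sum [simp]: "(\<And>i. i \<in> I \<Longrightarrow> f i \<in> S) \<Longrightarrow> sum f I \<in> S"
  using subspace_sum[OF subspace_S] by blast

lemmas ip_add_left = ip_add[OF inner_S] and ip_smul_left = ip_smul[OF inner_S]
  and ip_cnj = ip_sym[OF inner_S] and ip_pos_S = ip_pos[OF inner_S]

lemma ip_zero_left [simp]: "f \<in> S \<Longrightarrow> ip 0 f = 0"
  using ip_smul_left[of 0 f 0] by simp

lemma ip_diff_left: "f \<in> S \<Longrightarrow> g \<in> S \<Longrightarrow> h \<in> S \<Longrightarrow> ip (f - g) h = ip f h - ip g h"
  using ip_add_left[of "f - g" g h] by simp

lemma ip_zero_right [simp]: "f \<in> S \<Longrightarrow> ip f 0 = 0"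
  using ip_cnj[of 0 f] by simp

lemma ip_add_right: "f \<in> S \<Longrightarrow> g \<in> S \<Longrightarrow> h \<in> S \<Longrightarrow> ip h (f + g) = ip h f + ip h g"
  using ip_cnj[of "f + g" h] ip_add_left[of f g h] ip_cnj[of f h] ip_cnj[of g h] by simp

lemma ip_diff_right: "f \<in> S \<Longrightarrow> g \<in> S \<Longrightarrow> h \<in> S \<Longrightarrow> ip h (f - g) = ip h f - ip h g"
  using ip_cnj[of "f - g" h] ip_diff_left[of f g h] ip_cnj[of f h] ip_cnj[of g h] by simp

lemma ip_smul_right: "f \<in> S \<Longrightarrow> g \<in> S \<Longrightarrow> ip f (smul c g) = cnj c * ip f g"
  using ip_cnj[of "smul c g" f] ip_smul_left[of g f c] ip_cnj[of g f] by simp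

lemma Re_ip_nonneg: "f \<in> S \<Longrightarrow> 0 \<le> Re (ip f f)"
  using ip_pos_S[of f] by (cases "f = 0") auto

lemma nrm_nonneg [simp]: "f \<in> S \<Longrightarrow> 0 \<le> nrm f"
  by (simp add: ip_norm_def Re_ip_nonneg)

lemma nrm_sq: "f \<in> S \<Longrightarrow> (nrm f)\<^sup>2 = Re (ip f f)"
  by (simp add: ip_norm_def Re_ip_nonneg)

lemma ip_self: "f \<in> S \<Longrightarrow> ip f f = of_real ((nrm f)\<^sup>2)"
  using ip_cnj[of f f] by (simp add: nrm_sq complex_eq_iff)

lemma nrm_zero [simp]: "nrm 0 = 0"
  by (simp add: ip_norm_def)

lemma nrm_eq_0: "f \<in> S \<Longrightarrow> nrm f = 0 \<longleftrightarrow> f = 0"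
  using ip_pos_S[of f] by (cases "f = 0") (auto simp: ip_norm_def)

lemma nrm_smul: "f \<in> S \<Longrightarrow> nrm (smul c f) = cmod c * nrm f"
proof -
  assume f: "f \<in> S"
  have "ip (smul c f) (smul c f) = of_real ((cmod c)\<^sup>2 * (nrm f)\<^sup>2)"
    using f by (simp add: ip_smul_left ip_smul_right ip_self[OF f]
        complex_norm_square[unfolded of_real_power] mult_ac)
  then have "(nrm (smul c f))\<^sup>2 = (cmod c * nrm f)\<^sup>2"
    using f by (simp add: nrm_sq[of "smul c f"] power_mult_distrib del: of_real_mult of_real_power)
  then show ?thesis using f by (simp add: power2_eq_iff_nonneg)
qed

lemma nrm_residual:
  assumes f: "f \<in> S" and g: "g \<in> S" "g \<noteq> 0"
  shows "(nrm (f - smul (ip f g / ip g g) g))\<^sup>2 = (nrm f)\<^sup>2 - (cmod (ip f g))\<^sup>2 / (nrm g)\<^sup>2"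
proof -
  define c where "c = ip f g / ip g g"
  have n: "nrm g \<noteq> 0" using g nrm_eq_0 by blast
  have "ip (f - smul c g) (f - smul c g) = ip f f - cnj c * ip f g - c * cnj (ip f g) + c * cnj c * ip g g"
    using f g ip_cnj[OF f g(1)]
    by (simp add: ip_diff_left ip_diff_right ip_smul_left ip_smul_right algebra_simps)
  also have "c * cnj c * ip g g = c * cnj (ip f g)"
  proof -
    have "ip g g \<noteq> 0" "cnj (ip g g) = ip g g" using n by (auto simp: ip_self[OF g(1)])
    then show ?thesis by (simp add: c_def)
  qed
  finally have "ip (f - smul c g) (f - smul c g) = ip f f - cnj c * ip f g" by simp
  also have "cnj c * ip f g = of_real ((cmod (ip f g))\<^sup>2 / (nrm g)\<^sup>2)"
    using n ip_self[OF g(1)] by (simp add: c_def complex_norm_square[unfolded of_real_power] mult.commute)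
  finally have "Re (ip (f - smul c g) (f - smul c g)) = (nrm f)\<^sup>2 - (cmod (ip f g))\<^sup>2 / (nrm g)\<^sup>2"
    using ip_self[OF f] by simp
  then show ?thesis unfolding c_def[symmetric] using f g by (simp add: nrm_sq[of "f - smul c g"])
qed

lemma cauchy_schwarz:
  assumes f: "f \<in> S" and g: "g \<in> S"
  shows "cmod (ip f g) \<le> nrm f * nrm g"
proof (cases "g = 0")
  case False
  then have n: "nrm g > 0" using g nrm_eq_0[of g] nrm_nonneg[of g] by linarith
  have "0 \<le> (nrm f)\<^sup>2 - (cmod (ip f g))\<^sup>2 / (nrm g)\<^sup>2"
    using nrm_residual[OF f g False] by (metis zero_le_power2)
  then have "(cmod (ip f g))\<^sup>2 \<le> (nrm f * nrm g)\<^sup>2"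
    using n by (simp add: field_simps power_mult_distrib)
  then show ?thesis by (rule power2_le_imp_le) (use f g in simp)
qed (use f in simp)

lemma metric: "Metric_space S (ip_dist S ip)"
  by (rule Metric_space_ip_dist[OF vector_space_axioms subspace_S inner_S])

lemma nrm_diff_eq: "f \<in> S \<Longrightarrow> g \<in> S \<Longrightarrow> nrm (f - g) = ip_dist S ip f g"
  by (simp add: ip_dist_def)

lemma nrm_minus_commute: "f \<in> S \<Longrightarrow> g \<in> S \<Longrightarrow> nrm (f - g) = nrm (g - f)"
  using Metric_space.commute[OF metric, of f g] by (simp add: nrm_diff_eq)

lemma nrm_diff_triangle: "f \<in> S \<Longrightarrow> g \<in> S \<Longrightarrow> h \<in> S \<Longrightarrow> nrm (f - h) \<le> nrm (f - g) + nrm (g - h)"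
  using Metric_space.triangle[OF metric, of f g h] by (simp add: nrm_diff_eq)

lemma nrm_triangle: "f \<in> S \<Longrightarrow> g \<in> S \<Longrightarrow> nrm (f + g) \<le> nrm f + nrm g"
  using nrm_diff_triangle[of "f + g" g 0] by simp

lemma closure_iff:
  "A \<subseteq> S \<Longrightarrow> f \<in> ip_topology S ip closure_of A \<longleftrightarrow> f \<in> S \<and> (\<forall>r>0. \<exists>g\<in>A. nrm (f - g) < r)"
  by (auto simp: Metric_space.metric_closure_of[OF metric] Metric_space.in_mball[OF metric] nrm_diff_eq subset_iff)

text \<open>Closedness in terms of the norm alone, which is what the induction in
  \<open>finite_codim_approx\<close> can maintain.\<close>

definition norm_closed :: "'v set \<Rightarrow> bool"
  where "norm_closed M \<longleftrightarrow> M \<subseteq> S \<and> (\<forall>f\<in>S. (\<forall>r>0. \<exists>g\<in>M. nrm (f - g) < r) \<longrightarrow> f \<in> M)"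

lemma closedin_imp_norm_closed:
  assumes "closedin (ip_topology S ip) M"
  shows "norm_closed M"
proof -
  have M: "M \<subseteq> S" using closedin_subset[OF assms] Metric_space.topspace_mtopology[OF metric] by simp
  have "f \<in> M" if "f \<in> S" "\<forall>r>0. \<exists>g\<in>M. nrm (f - g) < r" for f
    using closure_of_closedin[OF assms] closure_iff[OF M, of f] that by blast
  with M show ?thesis unfolding norm_closed_def by blast
qed

lemma complete:
  assumes x: "\<And>n::nat. x n \<in> S"
    and cauchy: "\<And>r. r > 0 \<Longrightarrow> \<exists>N. \<forall>m\<ge>N. \<forall>n\<ge>N. nrm (x m - x n) < r"
  obtains l where "l \<in> S" "(\<lambda>n. nrm (x n - l)) \<longlonglongrightarrow> 0"
proof -
  interpret Metric_space S "ip_dist S ip" by (rule metric)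
  have "MCauchy x" unfolding MCauchy_def using x cauchy by (auto simp: nrm_diff_eq)
  then obtain l where l: "limitin mtopology x l sequentially"
    using hilbert by (auto simp: hilbert_space_on_def mcomplete_def)
  then have lS: "l \<in> S" and "\<And>r. r > 0 \<Longrightarrow> \<forall>\<^sub>F n in sequentially. x n \<in> S \<and> ip_dist S ip (x n) l < r"
    by (auto simp: limit_metric_sequentially eventually_sequentially)
  then have "(\<lambda>n. nrm (x n - l)) \<longlonglongrightarrow> 0"
    using x lS by (intro tendstoI) (simp add: nrm_diff_eq[symmetric])
  with lS show ?thesis by (rule that)
qed

lemma parallelogram:
  assumes f: "f \<in> S" and g: "g \<in> S"
  shows "(nrm (f - g))\<^sup>2 + (nrm (f + g))\<^sup>2 = 2 * (nrm f)\<^sup>2 + 2 * (nrm g)\<^sup>2"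
  using f g by (simp add: nrm_sq ip_add_left ip_add_right ip_diff_left ip_diff_right)

text \<open>The point \<open>m\<close> is the one nearest to \<open>b\<close>: a minimising sequence is Cauchy by the
  parallelogram law, and completeness supplies its limit.  Minimality gives orthogonality, as
  subtracting the component of \<open>b - m\<close> along \<open>h\<close> would otherwise shorten \<open>b - m\<close>.\<close>

lemma orthogonal_projection:
  assumes M: "subspace M" "norm_closed M" and b: "b \<in> S"
  obtains m where "m \<in> M" "\<And>h. h \<in> M \<Longrightarrow> ip (b - m) h = 0"
proof -
  have MS: "m \<in> M \<Longrightarrow> m \<in> S" for m using M(2) by (auto simp: norm_closed_def)
  have M0: "0 \<in> M" using M(1) by (rule subspace_0)
  define D where "D = (\<lambda>m. (nrm (b - m))\<^sup>2) ` M"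
  define d where "d = Inf D"
  have bdd: "bdd_below D" by (auto simp: D_def intro: bdd_belowI[of _ 0])
  have d_le: "d \<le> (nrm (b - m))\<^sup>2" if "m \<in> M" for m
    unfolding d_def using that by (intro cInf_lower bdd) (auto simp: D_def)
  have "\<exists>m\<in>M. (nrm (b - m))\<^sup>2 < d + 1 / real (Suc n)" for n
  proof -
    have "\<exists>y\<in>D. y < d + 1 / real (Suc n)"
      using M0 bdd by (subst cInf_less_iff[symmetric]) (auto simp: D_def d_def)
    then show ?thesis by (auto simp: D_def)
  qed
  then obtain x where x: "x n \<in> M" "(nrm (b - x n))\<^sup>2 < d + 1 / real (Suc n)" for n
    by metis
  have close: "(nrm (x m - x n))\<^sup>2 < 4 / real (Suc N)" if "m \<ge> N" "n \<ge> N" for m n N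
  proof -
    \<comment> \<open>the midpoint of two nearly optimal points is again at squared distance at least \<open>d\<close>\<close>
    define h where "h = smul (1/2) (x m + x n)"
    have h: "h \<in> M" unfolding h_def using M(1) x by (intro subspace_scale subspace_add)
    have "smul 2 b = b + b" using scale_left_distrib[of 1 1 b] by simp
    then have e: "(b - x n) + (b - x m) = smul 2 (b - h)"
      by (simp add: h_def scale_right_diff_distrib)
    have 1: "(nrm ((b - x n) - (b - x m)))\<^sup>2 + (nrm ((b - x n) + (b - x m)))\<^sup>2
        = 2 * (nrm (b - x n))\<^sup>2 + 2 * (nrm (b - x m))\<^sup>2"
      using b x MS by (intro parallelogram) auto
    have 2: "(nrm ((b - x n) + (b - x m)))\<^sup>2 = 4 * (nrm (b - h))\<^sup>2"
      unfolding e using b MS[OF h] by (simp add: nrm_smul power_mult_distrib)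
    have 3: "(b - x n) - (b - x m) = x m - x n" by simp
    have 4: "1 / real (Suc n) \<le> 1 / real (Suc N)" "1 / real (Suc m) \<le> 1 / real (Suc N)"
      using that by (simp_all add: frac_le)
    show ?thesis
      using 1[unfolded 2 3] 4 d_le[OF h] x(2)[of n] x(2)[of m] by linarith
  qed
  obtain l where l: "l \<in> S" "(\<lambda>n. nrm (x n - l)) \<longlonglongrightarrow> 0"
  proof (rule complete)
    show "x n \<in> S" for n using x MS by blast
    fix r :: real assume r: "r > 0"
    obtain N where N: "4 / r\<^sup>2 < real N" using reals_Archimedean2 by blast
    have "4 < real N * r\<^sup>2" using N r by (simp add: pos_divide_less_eq)
    also have "\<dots> \<le> real (Suc N) * r\<^sup>2" by (intro mult_right_mono) auto
    finally have N': "4 / real (Suc N) < r\<^sup>2" by (simp add: pos_divide_less_eq mult.commute)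
    have "nrm (x m - x n) < r" if "m \<ge> N" "n \<ge> N" for m n
      using less_trans[OF close[OF that] N'] r by (intro power2_less_imp_less[of _ r]) simp_all
    then show "\<exists>N. \<forall>m\<ge>N. \<forall>n\<ge>N. nrm (x m - x n) < r" by blast
  qed
  have xS: "x n \<in> S" for n using x MS by blast
  have lM: "l \<in> M"
  proof -
    have "\<exists>g\<in>M. nrm (l - g) < r" if "r > 0" for r
    proof -
      obtain n where "nrm (x n - l) < r"
        using order_tendstoD(2)[OF l(2) \<open>r > 0\<close>] by (auto simp: eventually_sequentially)
      then show ?thesis using x(1) nrm_minus_commute[OF l(1) xS] by metis
    qed
    then show ?thesis using M(2) l(1) by (auto simp: norm_closed_def)
  qed
  have "(nrm (b - l)) \<le> sqrt d"
  proof (rule field_le_epsilon)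
    fix e :: real assume "e > 0"
    have lim: "(\<lambda>n. sqrt (d + 1 / real (Suc n)) + nrm (x n - l)) \<longlonglongrightarrow> sqrt (d + 0) + 0"
      by (intro tendsto_intros l LIMSEQ_Suc[OF lim_1_over_n])
    have "nrm (b - l) \<le> sqrt (d + 1 / real (Suc n)) + nrm (x n - l)" for n
    proof -
      have "nrm (b - x n) \<le> sqrt (d + 1 / real (Suc n))"
        using x(2)[of n] by (intro real_le_rsqrt) simp
      then show ?thesis using nrm_diff_triangle[OF b xS l(1), of n] by simp
    qed
    then have "nrm (b - l) \<le> sqrt (d + 0) + 0"
      by (intro LIMSEQ_le_const[OF lim]) auto
    then show "nrm (b - l) \<le> sqrt d + e" using \<open>e > 0\<close> by simp
  qed
  moreover have "d \<ge> 0" unfolding d_def using M0 by (intro cInf_greatest) (auto simp: D_def)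
  ultimately have best: "(nrm (b - l))\<^sup>2 \<le> d"
    using b l by (metis nrm_nonneg S_mem(4) power_mono real_sqrt_pow2)
  have "ip (b - l) h = 0" if h: "h \<in> M" for h
  proof (cases "h = 0")
    case False
    define c where "c = ip (b - l) h / ip h h"
    have n: "nrm h \<noteq> 0" using False MS[OF h] nrm_eq_0 by blast
    have "l + smul c h \<in> M" using M(1) lM h by (intro subspace_add subspace_scale)
    then have "d \<le> (nrm (b - (l + smul c h)))\<^sup>2" by (rule d_le)
    also have "b - (l + smul c h) = b - l - smul c h" by simp
    also have "(nrm (b - l - smul c h))\<^sup>2 = (nrm (b - l))\<^sup>2 - (cmod (ip (b - l) h))\<^sup>2 / (nrm h)\<^sup>2"
      unfolding c_def using b l MS[OF h] False by (intro nrm_residual) auto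
    finally have "(cmod (ip (b - l) h))\<^sup>2 / (nrm h)\<^sup>2 \<le> 0" using best by linarith
    then show ?thesis using n by (simp add: divide_le_0_iff)
  qed (use b l in simp)
  with lM show ?thesis by (rule that)
qed

text \<open>One may think of \<open>E\<close> as a basis of the orthogonal complement of \<open>M\<close>.  In the induction step
  let \<open>e\<close> be the normalised component of one more vector \<open>b\<close> orthogonal to \<open>M\<close>.  The hypothesis
  applies to \<open>M' = M \<oplus> \<complex> e\<close>, and an approximant in \<open>M'\<close> is moved into \<open>M\<close> by removing its
  component along \<open>e\<close>.  The set \<open>M'\<close> is closed because membership is tested by the bounded map
  that removes this component.\<close>

lemma finite_codim_approx:
  assumes "finite B" "B \<subseteq> S" "subspace M" "norm_closed M"
    and "\<And>f. f \<in> S \<Longrightarrow> \<exists>g\<in>M. f - g \<in> span B"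
  shows "\<exists>E C. finite E \<and> E \<subseteq> S \<and> 0 \<le> C \<and>
    (\<forall>f\<in>S. \<exists>g\<in>M. nrm (f - g) \<le> C * (\<Sum>e\<in>E. cmod (ip f e)))"
  using assms
proof (induction B arbitrary: M rule: finite_induct)
  case empty
  have "\<exists>g\<in>M. nrm (f - g) \<le> 0 * (\<Sum>e\<in>{}. cmod (ip f e))" if "f \<in> S" for f
    using empty.prems(4)[OF that] by (metis (no_types) span_empty nrm_zero singletonD mult_zero_left order_refl)
  then show ?case by (intro exI[of _ "{}"] exI[of _ 0]) auto
next
  case (insert b B)
  note M = insert.prems(2,3)
  have MS: "m \<in> M \<Longrightarrow> m \<in> S" for m using M(2) by (auto simp: norm_closed_def)
  have b: "b \<in> S" using insert.prems by auto
  obtain m where m: "m \<in> M" "\<And>h. h \<in> M \<Longrightarrow> ip (b - m) h = 0"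
    using orthogonal_projection[OF M b] by blast
  \<comment> \<open>if \<open>b \<in> M\<close>, then \<open>b = m\<close>, and \<open>1 / 0 = 0\<close> makes \<open>e\<close> vanish; then \<open>M' = M\<close>, and all steps
    below remain valid\<close>
  define e where "e = smul (of_real (1 / nrm (b - m))) (b - m)"
  have bm: "b - m \<in> S" using b m MS by auto
  have e: "e \<in> S" using bm by (simp add: e_def)
  have e1: "nrm e \<le> 1"
    using nrm_smul[OF bm, of "of_real (1 / nrm (b - m))"] nrm_nonneg[OF bm]
    unfolding e_def by (simp add: norm_divide)
  have Me: "ip h e = 0" if "h \<in> M" for h
    using m(2)[OF that] ip_cnj[OF bm MS[OF that]] bm MS[OF that] by (simp add: e_def ip_smul_right)
  define M' where "M' = {f \<in> S. f - smul (ip f e) e \<in> M}"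
  have sub: "M \<subseteq> M'" using MS Me by (auto simp: M'_def)
  have M'S: "M' \<subseteq> S" by (auto simp: M'_def)
  have M'I: "f \<in> M'" if "f \<in> S" "f - smul (ip f e) e = g" "g \<in> M" for f g
    using that by (simp add: M'_def)
  have "subspace M'"
  proof (rule subspaceI)
    show "0 \<in> M'" using sub subspace_0[OF M(1)] by auto
    fix f g c assume f: "f \<in> M'" and g: "g \<in> M'"
    have "(f + g) - smul (ip (f + g) e) e = (f - smul (ip f e) e) + (g - smul (ip g e) e)"
      using f g e M'S by (subst ip_add_left) (auto simp: scale_left_distrib)
    moreover have "\<dots> \<in> M" using f g by (intro subspace_add[OF M(1)]) (auto simp: M'_def)
    ultimately show "f + g \<in> M'" by (rule M'I[rotated]) (use f g M'S in \<open>blast intro: S_mem\<close>)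
    have "smul c f - smul (ip (smul c f) e) e = smul c (f - smul (ip f e) e)"
      using f e M'S by (subst ip_smul_left) (auto simp: scale_right_diff_distrib)
    moreover have "\<dots> \<in> M" using f by (intro subspace_scale[OF M(1)]) (auto simp: M'_def)
    ultimately show "smul c f \<in> M'" by (rule M'I[rotated]) (use f M'S in \<open>blast intro: S_mem\<close>)
  qed
  moreover have "norm_closed M'"
    unfolding norm_closed_def
  proof (intro conjI ballI impI)
    fix f assume f: "f \<in> S" and lim: "\<forall>r>0. \<exists>g\<in>M'. nrm (f - g) < r"
    let ?P = "\<lambda>f. f - smul (ip f e) e"
    have "\<exists>g\<in>M. nrm (?P f - g) < r" if "r > 0" for r
    proof -
      obtain g where g: "g \<in> M'" "nrm (f - g) < r / 2" using lim \<open>r > 0\<close> half_gt_zero by blast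
      have gS: "g \<in> S" using g M'S by auto
      have 1: "?P f - ?P g = (f - g) - smul (ip (f - g) e) e"
        using f gS e by (simp add: ip_diff_left scale_left_diff_distrib)
      have 2: "nrm ((f - g) - smul (ip (f - g) e) e) \<le> nrm (f - g) + cmod (ip (f - g) e) * nrm e"
        using nrm_diff_triangle[of "f - g" 0 "smul (ip (f - g) e) e"] f gS e
          nrm_minus_commute[of 0 "smul (ip (f - g) e) e"] by (simp add: nrm_smul)
      have 3: "cmod (ip (f - g) e) * nrm e \<le> nrm (f - g)"
      proof -
        have "cmod (ip (f - g) e) * nrm e \<le> (nrm (f - g) * 1) * 1"
          using cauchy_schwarz[of "f - g" e] f gS e e1
          by (intro mult_mono order_trans[OF cauchy_schwarz]) auto
        then show ?thesis by simp
      qed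
      have "nrm (?P f - ?P g) < r" unfolding 1 using 2 3 g(2) by linarith
      then show ?thesis using g by (auto simp: M'_def)
    qed
    then have "?P f \<in> M" using M(2) f e by (auto simp: norm_closed_def)
    then show "f \<in> M'" using f by (simp add: M'_def)
  qed (rule M'S)
  moreover have "\<exists>g\<in>M'. f - g \<in> span B" if f: "f \<in> S" for f
  proof -
    obtain g where g: "g \<in> M" "f - g \<in> span (insert b B)" using insert.prems(4)[OF f] by blast
    then obtain c where c: "f - g - smul c b \<in> span B" using span_breakdown[of b "insert b B"]
      by (metis Diff_insert_absorb insert.hyps(2) insertI1)
    have "ip b e = of_real (nrm (b - m))"
    proof -
      have "ip b e = ip (b - m) e" using Me[OF m(1)] b e MS[OF m(1)] by (simp add: ip_diff_left)
      also have "\<dots> = of_real (1 / nrm (b - m)) * ip (b - m) (b - m)"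
        unfolding e_def using ip_smul_right[OF bm bm] by simp
      also have "\<dots> = of_real (nrm (b - m))"
        unfolding ip_self[OF bm] of_real_mult[symmetric] by (simp add: power2_eq_square)
      finally show ?thesis .
    qed
    then have "smul (ip b e) e = b - m"
      using nrm_eq_0[OF bm] by (cases "b = m") (auto simp: e_def)
    then have "b \<in> M'" using b m by (simp add: M'_def)
    then have "g + smul c b \<in> M'" using g sub \<open>subspace M'\<close> by (meson subsetD subspace_add subspace_scale)
    then show ?thesis using c by (metis diff_diff_eq)
  qed
  ultimately obtain E C where E: "finite E" "E \<subseteq> S" "0 \<le> C"
    and approx: "\<And>f. f \<in> S \<Longrightarrow> \<exists>g\<in>M'. nrm (f - g) \<le> C * (\<Sum>e\<in>E. cmod (ip f e))"
    using insert.IH[of M'] insert.prems(1) by auto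
  have "\<exists>g\<in>M. nrm (f - g) \<le> (2 * C + 1) * (\<Sum>e\<in>insert e E. cmod (ip f e))" if f: "f \<in> S" for f
  proof -
    obtain g where g: "g \<in> M'" "nrm (f - g) \<le> C * (\<Sum>e\<in>E. cmod (ip f e))" using approx[OF f] by blast
    have gS: "g \<in> S" using g M'S by auto
    let ?h = "g - smul (ip g e) e"
    have h: "?h \<in> M" using g by (simp add: M'_def)
    have "nrm (f - ?h) \<le> nrm (f - g) + nrm (smul (ip g e) e)"
      using nrm_diff_triangle[OF f gS, of ?h] gS e by simp
    also have "nrm (smul (ip g e) e) \<le> cmod (ip g e)"
      using e e1 by (simp add: nrm_smul mult_left_le)
    also have "cmod (ip g e) \<le> cmod (ip f e) + cmod (ip (f - g) e)"
      using f gS e norm_triangle_ineq4[of "ip f e" "ip (f - g) e"] by (simp add: ip_diff_left)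
    also have "cmod (ip (f - g) e) \<le> nrm (f - g)"
      using cauchy_schwarz[of "f - g" e] f gS e e1 by (meson S_mem(4) mult_left_le nrm_nonneg order_trans)
    finally have "nrm (f - ?h) \<le> 2 * nrm (f - g) + cmod (ip f e)" by simp
    also have "\<dots> \<le> 2 * C * (\<Sum>e\<in>E. cmod (ip f e)) + cmod (ip f e)" using g by simp
    also have "\<dots> \<le> (2 * C + 1) * (\<Sum>e\<in>insert e E. cmod (ip f e))"
    proof -
      have "(\<Sum>e\<in>E. cmod (ip f e)) \<le> (\<Sum>e\<in>insert e E. cmod (ip f e))"
        using E by (intro sum_mono2) auto
      moreover have "cmod (ip f e) \<le> (\<Sum>e\<in>insert e E. cmod (ip f e))"
        using E by (intro member_le_sum) auto
      ultimately show ?thesis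
        using \<open>0 \<le> C\<close> by (simp only: distrib_right mult_1) (intro add_mono mult_left_mono, auto)
    qed
    finally show ?thesis using h by blast
  qed
  then show ?case
    using E e by (intro exI[of _ "insert e E"] exI[of _ "2 * C + 1"]) auto
qed

end

section \<open>The tensor product as a Hilbert space\<close>

lemma subspace_tensor_Cn:
  assumes "cfun.subspace H" shows "vfun.subspace (tensor_Cn H)"
  unfolding tensor_Cn_eq_span[OF assms] by (rule vfun.subspace_span)

text \<open>Completeness holds because convergence in the tensor product is convergence of each of
  the finitely many components.\<close>

lemma hilbert_space_on_tensor:
  assumes "hilbert_space_on cscale H ip"
  shows "hilbert_space_on vscale (tensor_Cn H :: ('a \<Rightarrow> complex ^ 'n) set) (tensor_ip ip)"
proof -
  interpret H: hilbert_carrier cscale H ip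
    by unfold_locales (rule assms)
  let ?T = "tensor_Cn H :: ('a \<Rightarrow> complex ^ 'n) set"
  have sub: "vfun.subspace ?T" by (rule subspace_tensor_Cn[OF H.subspace_S])
  have inner: "inner_product_on vscale ?T (tensor_ip ip)"
    by (rule inner_product_on_tensor[OF H.inner_S H.subspace_S])
  interpret T: Metric_space ?T "ip_dist ?T (tensor_ip ip)"
    by (rule Metric_space_ip_dist[OF vfun.vector_space_axioms sub inner])
  let ?c = "\<lambda>(F :: 'a \<Rightarrow> complex ^ 'n) i z. F z $ i"
  have comp: "?c F i \<in> H" if "F \<in> ?T" for F i using that by (auto simp: tensor_Cn_def)
  have diffT: "F - G \<in> ?T" if "F \<in> ?T" "G \<in> ?T" for F G using vfun.subspace_diff[OF sub] that .
  have dist: "ip_dist ?T (tensor_ip ip) F G = sqrt (\<Sum>i\<in>UNIV. (H.nrm (?c F i - ?c G i))\<^sup>2)"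
    if "F \<in> ?T" "G \<in> ?T" for F G
  proof -
    have "?c (F - G) i = ?c F i - ?c G i" for i by (simp add: fun_eq_iff)
    then have "tensor_ip ip (F - G) (F - G) = (\<Sum>i\<in>UNIV. ip (?c F i - ?c G i) (?c F i - ?c G i))"
      unfolding tensor_ip_def by metis
    then show ?thesis
      using that by (simp add: ip_dist_def ip_norm_def[of "tensor_ip ip"] Re_sum H.nrm_sq comp)
  qed
  have "T.mcomplete"
    unfolding T.mcomplete_def
  proof (intro allI impI)
    fix x assume x: "T.MCauchy x"
    then have xT: "x n \<in> ?T" for n by (auto simp: T.MCauchy_def)
    have "\<exists>l\<in>H. (\<lambda>n. H.nrm (?c (x n) i - l)) \<longlonglongrightarrow> 0" for i
    proof -
      obtain l where "l \<in> H" "(\<lambda>n. H.nrm (?c (x n) i - l)) \<longlonglongrightarrow> 0"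
      proof (rule H.complete)
        show "?c (x n) i \<in> H" for n using comp[OF xT] .
        fix r :: real assume "r > 0"
        then obtain N where N: "\<And>m n. m \<ge> N \<Longrightarrow> n \<ge> N \<Longrightarrow> ip_dist ?T (tensor_ip ip) (x m) (x n) < r"
          using x unfolding T.MCauchy_def by meson
        have "H.nrm (?c (x m) i - ?c (x n) i) < r" if "m \<ge> N" "n \<ge> N" for m n
        proof -
          have "(H.nrm (?c (x m) i - ?c (x n) i))\<^sup>2 \<le> (\<Sum>i\<in>UNIV. (H.nrm (?c (x m) i - ?c (x n) i))\<^sup>2)"
            by (rule member_le_sum) auto
          then have "H.nrm (?c (x m) i - ?c (x n) i) \<le> ip_dist ?T (tensor_ip ip) (x m) (x n)"
            unfolding dist[OF xT xT] by (rule real_le_rsqrt)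
          also have "\<dots> < r" using N that .
          finally show ?thesis .
        qed
        then show "\<exists>N. \<forall>m\<ge>N. \<forall>n\<ge>N. H.nrm (?c (x m) i - ?c (x n) i) < r" by blast
      qed
      then show ?thesis by blast
    qed
    then obtain l where l: "\<And>i. l i \<in> H" "\<And>i. (\<lambda>n. H.nrm (?c (x n) i - l i)) \<longlonglongrightarrow> 0" by metis
    define L where "L = (\<lambda>z. \<chi> i. l i z)"
    have cL: "?c L i = l i" for i by (simp add: L_def)
    have LT: "L \<in> ?T" using l by (simp add: tensor_Cn_def cL)
    have "(\<lambda>n. sqrt (\<Sum>i\<in>UNIV. (H.nrm (?c (x n) i - l i))\<^sup>2)) \<longlonglongrightarrow> sqrt (\<Sum>i\<in>(UNIV::'n set). 0\<^sup>2)"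
      by (intro tendsto_intros l)
    then have "(\<lambda>n. ip_dist ?T (tensor_ip ip) (x n) L) \<longlonglongrightarrow> 0"
      using dist[OF xT LT] by (simp add: cL)
    then have "limitin T.mtopology x L sequentially"
      using LT xT by (simp add: T.limit_metric_sequentially order_tendstoD eventually_sequentially[symmetric])
    then show "\<exists>L. limitin T.mtopology x L sequentially" by blast
  qed
  with sub inner show ?thesis by (simp add: hilbert_space_on_def)
qed

lemma ip_norm_tensor:
  assumes "hilbert_space_on cscale H ip" and "F \<in> tensor_Cn H"
  shows "(ip_norm (tensor_ip ip) F)\<^sup>2 = (\<Sum>i\<in>UNIV. (ip_norm ip (\<lambda>z. F z $ i))\<^sup>2)"
proof -
  interpret H: hilbert_carrier cscale H ip
    by unfold_locales (rule assms)
  have m: "(\<lambda>z. F z $ i) \<in> H" for i using assms(2) by (auto simp: tensor_Cn_def)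
  show ?thesis
    unfolding H.nrm_sq[OF m] ip_norm_def[of "tensor_ip ip"] tensor_ip_def Re_sum
    by (intro real_sqrt_pow2 sum_nonneg H.Re_ip_nonneg m)
qed


section \<open>Annihilating polynomials of a finite-dimensional quotient\<close>

text \<open>Stated for families, so that repetitions among the \<open>b n\<close> count as dependence.\<close>

lemma (in vector_space) family_in_span_dependent:
  assumes B: "finite B" and b: "\<And>n::nat. b n \<in> span B"
  obtains c where "\<exists>n\<le>card B. c n \<noteq> 0" "(\<Sum>n\<le>card B. scale (c n) (b n)) = 0"
proof (cases "inj_on b {..card B}")
  case True
  have "dependent (b ` {..card B})"
  proof (rule ccontr)
    assume "independent (b ` {..card B})"
    then have "card (b ` {..card B}) \<le> card B"
      using independent_span_bound[OF B] b by blast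
    then show False using card_image[OF True] by simp
  qed
  then obtain u where "\<exists>v\<in>b ` {..card B}. u v \<noteq> 0" "(\<Sum>v\<in>b ` {..card B}. scale (u v) v) = 0"
    by (subst (asm) dependent_finite) auto
  then show ?thesis
    using that[of "u \<circ> b"] by (auto simp: sum.reindex[OF True])
next
  case False
  then obtain m n where mn: "m \<le> card B" "n \<le> card B" "m \<noteq> n" "b m = b n"
    by (auto simp: inj_on_def)
  define c :: "nat \<Rightarrow> 'a" where "c k = (if k = m then 1 else 0) - (if k = n then 1 else 0)" for k
  have "(\<Sum>k\<le>card B. scale (c k) (b k))
      = (\<Sum>k\<le>card B. if k = m then b k else 0) - (\<Sum>k\<le>card B. if k = n then b k else 0)"
    by (simp add: c_def scale_left_diff_distrib sum_subtractf if_distrib[of "\<lambda>c. scale c _"] cong: if_cong)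
  also have "\<dots> = 0" using mn by simp
  finally have "(\<Sum>k\<le>card B. scale (c k) (b k)) = 0" .
  moreover have "\<exists>k\<le>card B. c k \<noteq> 0"
    using mn(1,3) by (intro exI[of _ m]) (simp add: c_def)
  ultimately show ?thesis by (rule that[rotated])
qed

definition poly_mult :: "'d \<Rightarrow> complex poly \<Rightarrow> (complex ^ 'd \<Rightarrow> complex ^ 'n) \<Rightarrow> complex ^ 'd \<Rightarrow> complex ^ 'n"
  where "poly_mult j p F = (\<lambda>z. poly p (z $ j) *s F z)"

lemma poly_mult_zero_poly: "poly_mult j 0 F = 0"
  by (simp add: poly_mult_def fun_eq_iff)

lemma poly_mult_zero: "poly_mult j p 0 = 0"
  by (simp add: poly_mult_def fun_eq_iff)

lemma poly_mult_pCons: "poly_mult j (pCons a p) F = vscale a F + coord_mult_tensor j (poly_mult j p F)"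
  by (simp add: poly_mult_def vscale_def coord_mult_tensor_def fun_eq_iff vec_eq_iff algebra_simps)

lemma poly_mult_times: "poly_mult j (p * q) F = poly_mult j p (poly_mult j q F)"
  by (simp add: poly_mult_def fun_eq_iff vec_eq_iff mult.assoc)

lemma poly_mult_add: "poly_mult j p (F + G) = poly_mult j p F + poly_mult j p G"
  by (simp add: poly_mult_def fun_eq_iff vec_eq_iff algebra_simps)

lemma poly_mult_scale: "poly_mult j p (vscale c F) = vscale c (poly_mult j p F)"
  by (simp add: poly_mult_def vscale_def fun_eq_iff vec_eq_iff)

lemma poly_mult_mem:
  assumes "vfun.subspace M" "coord_mult_tensor j ` M \<subseteq> M" "F \<in> M"
  shows "poly_mult j p F \<in> M"
proof (induction p)
  case 0
  then show ?case using vfun.subspace_0[OF assms(1)] by (simp only: poly_mult_zero_poly)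
next
  case (pCons a p)
  then have "coord_mult_tensor j (poly_mult j p F) \<in> M" using assms(2) by blast
  then show ?case
    unfolding poly_mult_pCons using assms(1,3) by (intro vfun.subspace_add vfun.subspace_scale)
qed

text \<open>Multiplication by \<open>z\<^sub>j\<close> acts on the finite-dimensional quotient \<open>T / M\<close>.  The powers of
  \<open>z\<^sub>j\<close> applied to one vector are linearly dependent modulo \<open>M\<close>, which gives a polynomial for that
  vector; the product of the polynomials for the members of \<open>B\<close> works for all of \<open>T\<close>.\<close>

lemma annihilating_poly:
  fixes M T :: "(complex ^ 'd \<Rightarrow> complex ^ 'n) set"
  assumes M: "vfun.subspace M" "coord_mult_tensor j ` M \<subseteq> M"
    and T: "vfun.subspace T" "coord_mult_tensor j ` T \<subseteq> T"
    and B: "finite B" "B \<subseteq> T" and quot: "\<And>F. F \<in> T \<Longrightarrow> \<exists>G\<in>M. F - G \<in> vfun.span B"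
  obtains p where "p \<noteq> 0" "\<And>F. F \<in> T \<Longrightarrow> poly_mult j p F \<in> M"
proof -
  have "\<exists>p. p \<noteq> 0 \<and> poly_mult j p F \<in> M" if F: "F \<in> T" for F
  proof -
    define x where "x n = poly_mult j (monom 1 n) F" for n
    have "x n \<in> T" for n unfolding x_def by (rule poly_mult_mem[OF T F])
    then have "\<forall>n. \<exists>G. G \<in> M \<and> x n - G \<in> vfun.span B" using quot by blast
    then obtain G where G: "\<And>n. G n \<in> M" "\<And>n. x n - G n \<in> vfun.span B" by metis
    obtain c where c: "\<exists>n\<le>card B. c n \<noteq> 0" "(\<Sum>n\<le>card B. vscale (c n) (x n - G n)) = 0"
      using vfun.family_in_span_dependent[OF B(1), of "\<lambda>n. x n - G n"] G(2) by blast
    define p where "p = (\<Sum>n\<le>card B. monom (c n) n)"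
    have "coeff p n = c n" if "n \<le> card B" for n
      using that by (simp add: p_def coeff_sum)
    then have "p \<noteq> 0" using c(1) by auto
    have sum_apply: "(\<Sum>n\<in>I. g n) z = (\<Sum>n\<in>I. g n z)" for g :: "nat \<Rightarrow> complex ^ 'd \<Rightarrow> complex ^ 'n" and z I
      by (induction I rule: infinite_finite_induct) auto
    have "poly_mult j p F = (\<Sum>n\<le>card B. vscale (c n) (x n))"
      by (simp add: fun_eq_iff vec_eq_iff poly_mult_def p_def x_def vscale_def sum_apply poly_sum poly_monom
          sum_distrib_right mult.assoc)
    also have "\<dots> = (\<Sum>n\<le>card B. vscale (c n) (G n))"
      using c(2) by (simp add: vfun.scale_right_diff_distrib sum_subtractf)
    also have "\<dots> \<in> M" using G by (intro vfun.subspace_sum[OF M(1)] vfun.subspace_scale[OF M(1)])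
    finally show ?thesis using \<open>p \<noteq> 0\<close> by blast
  qed
  then obtain q where q: "\<And>F. F \<in> T \<Longrightarrow> q F \<noteq> 0" "\<And>F. F \<in> T \<Longrightarrow> poly_mult j (q F) F \<in> M" by metis
  define p where "p = (\<Prod>b\<in>B. q b)"
  have "p \<noteq> 0" using B q(1) by (auto simp: p_def)
  have pB: "poly_mult j p b \<in> M" if "b \<in> B" for b
  proof -
    have "p = (\<Prod>b\<in>B - {b}. q b) * q b"
      using that B by (simp add: p_def prod.remove mult.commute)
    then show ?thesis using poly_mult_mem[OF M q(2)] that B by (auto simp: poly_mult_times)
  qed
  have span: "poly_mult j p F \<in> M" if "F \<in> vfun.span B" for F
    using that
  proof (induction rule: vfun.span_induct_alt)
    case base
    show ?case using vfun.subspace_0[OF M(1)] by (simp only: poly_mult_zero)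
  next
    case (step c x y)
    then show ?case
      unfolding poly_mult_add poly_mult_scale using pB M(1)
      by (intro vfun.subspace_add vfun.subspace_scale)
  qed
  have "poly_mult j p F \<in> M" if F: "F \<in> T" for F
  proof -
    obtain G where G: "G \<in> M" "F - G \<in> vfun.span B" using quot[OF F] by blast
    have "poly_mult j p (G + (F - G)) \<in> M"
      unfolding poly_mult_add using G by (intro vfun.subspace_add[OF M(1)] span poly_mult_mem M)
    then show ?thesis by simp
  qed
  with \<open>p \<noteq> 0\<close> show ?thesis by (rule that)
qed


section \<open>The Hermitian product\<close>

definition hprod :: "complex ^ 'n \<Rightarrow> complex ^ 'n \<Rightarrow> complex"
  where "hprod u v = (\<Sum>i\<in>UNIV. u $ i * cnj (v $ i))"

lemma cmod_hprod_le: "cmod (hprod u v) \<le> norm u * norm v"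
proof -
  have "cmod (hprod u v) \<le> (\<Sum>i\<in>UNIV. \<bar>cmod (u $ i)\<bar> * \<bar>cmod (v $ i)\<bar>)"
    unfolding hprod_def by (rule sum_norm_le) (simp add: norm_mult)
  also have "\<dots> \<le> norm u * norm v"
    unfolding norm_vec_def by (rule L2_set_mult_ineq)
  finally show ?thesis .
qed

lemma Re_hprod: "Re (hprod u v) = inner u v"
  by (simp add: hprod_def inner_vec_def inner_complex_def)

lemma hprod_self: "hprod u u = of_real ((norm u)\<^sup>2)"
proof (rule complex_eqI)
  show "Re (hprod u u) = Re (of_real ((norm u)\<^sup>2))"
    by (simp add: Re_hprod power2_norm_eq_inner del: of_real_power)
  have "Im (u $ i * cnj (u $ i)) = 0" for i by simp
  then have "Im (hprod u u) = 0" unfolding hprod_def Im_sum by simp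
  then show "Im (hprod u u) = Im (of_real ((norm u)\<^sup>2))" by simp
qed

lemma hprod_scale_left: "hprod (c *s u) v = c * hprod u v"
  by (simp add: hprod_def sum_distrib_left mult.assoc)

lemma norm_scale_vec: "norm (c *s (v :: complex ^ 'n)) = cmod c * norm v"
proof -
  have "(norm (c *s v))\<^sup>2 = (cmod c * norm v)\<^sup>2"
    by (simp add: norm_vec_def L2_set_def norm_mult power_mult_distrib sum_distrib_left sum_nonneg)
  then show ?thesis by (simp add: power2_eq_iff_nonneg)
qed

section \<open>Boundary behaviour of the kernel\<close>

definition boundary_filter :: "'a::metric_space set \<Rightarrow> 'a filter"
  where "boundary_filter \<Omega> = inf (filtercomap (\<lambda>z. infdist z (frontier \<Omega>)) (nhds 0)) (principal \<Omega>)"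

lemma eventually_boundary_filter:
  "eventually P (boundary_filter \<Omega>) \<longleftrightarrow> (\<exists>\<delta>>0. \<forall>z\<in>\<Omega>. infdist z (frontier \<Omega>) < \<delta> \<longrightarrow> P z)"
proof
  assume "eventually P (boundary_filter \<Omega>)"
  then obtain Q \<delta> where "\<delta> > 0" "\<And>t. dist t 0 < \<delta> \<Longrightarrow> Q t"
    and Q: "\<And>z. Q (infdist z (frontier \<Omega>)) \<Longrightarrow> z \<in> \<Omega> \<Longrightarrow> P z"
    unfolding boundary_filter_def eventually_inf_principal eventually_filtercomap eventually_nhds_metric
    by blast
  then show "\<exists>\<delta>>0. \<forall>z\<in>\<Omega>. infdist z (frontier \<Omega>) < \<delta> \<longrightarrow> P z"
    by (intro exI[of _ \<delta>]) (auto simp: infdist_nonneg)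
next
  assume "\<exists>\<delta>>0. \<forall>z\<in>\<Omega>. infdist z (frontier \<Omega>) < \<delta> \<longrightarrow> P z"
  then obtain \<delta> where "\<delta> > 0" "\<And>z. z \<in> \<Omega> \<Longrightarrow> infdist z (frontier \<Omega>) < \<delta> \<Longrightarrow> P z" by blast
  then show "eventually P (boundary_filter \<Omega>)"
    unfolding boundary_filter_def eventually_inf_principal eventually_filtercomap eventually_nhds_metric
    by (intro exI[of _ "\<lambda>t. t < \<delta>"]) (auto intro!: exI[of _ \<delta>])
qed

lemma eventually_boundary_filter_mem: "eventually (\<lambda>z. z \<in> \<Omega>) (boundary_filter \<Omega>)"
  by (auto simp: eventually_boundary_filter intro: exI[of _ 1])

text \<open>A unitary isomorphism between submodules and its inverse are both instances, with the full
  tensor product as the target.\<close>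

locale module_embedding = holomorphic_rkhs \<Omega> H ip \<KK>
  for \<Omega> :: "(complex ^ 'd) set"
    and H :: "(complex ^ 'd \<Rightarrow> complex) set"
    and ip :: "(complex ^ 'd \<Rightarrow> complex) \<Rightarrow> (complex ^ 'd \<Rightarrow> complex) \<Rightarrow> complex"
    and \<KK> :: "complex ^ 'd \<Rightarrow> complex ^ 'd \<Rightarrow> complex" +
  fixes M :: "(complex ^ 'd \<Rightarrow> complex ^ 'n) set"
    and U :: "(complex ^ 'd \<Rightarrow> complex ^ 'n) \<Rightarrow> complex ^ 'd \<Rightarrow> complex ^ 'n"
  assumes two_coordinates: "CARD('d) \<ge> 2"
    and open_domain: "open \<Omega>" and bounded_domain: "bounded \<Omega>"
    and polynomials_sub: "polynomials \<Omega> \<subseteq> H"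
    and polynomials_dense: "ip_topology H ip closure_of polynomials \<Omega> = H"
    and coord_mult_bounded: "\<And>j. bounded_on H ip (coord_mult j)"
    and kernel_blowup: "tends_to_infinity_at_boundary \<Omega> (\<lambda>z. Re (\<KK> z z))"
    and submodule_M: "submodule H ip M" and finite_codim_M: "finite_codim H M"
    and U_mem: "F \<in> M \<Longrightarrow> U F \<in> tensor_Cn H"
    and U_add: "F \<in> M \<Longrightarrow> G \<in> M \<Longrightarrow> U (F + G) = U F + U G"
    and U_scale: "F \<in> M \<Longrightarrow> U (vscale c F) = vscale c (U F)"
    and U_isometric: "F \<in> M \<Longrightarrow> G \<in> M \<Longrightarrow> tensor_ip ip (U F) (U G) = tensor_ip ip F G"
    and U_coord: "F \<in> M \<Longrightarrow> U (coord_mult_tensor j F) = coord_mult_tensor j (U F)"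
begin

abbreviation T :: "(complex ^ 'd \<Rightarrow> complex ^ 'n) set" where "T \<equiv> tensor_Cn H"
abbreviation tip where "tip \<equiv> tensor_ip ip"

sublocale H: hilbert_carrier cscale H ip
  by unfold_locales (rule hilbert)

sublocale T: hilbert_carrier vscale T tip
  by unfold_locales (rule hilbert_space_on_tensor[OF hilbert])

lemma M_subspace: "vfun.subspace M" and M_coord: "coord_mult_tensor j ` M \<subseteq> M"
  and M_sub: "M \<subseteq> T" and M_closed: "T.norm_closed M"
  using submodule_M finite_codim_M T.closedin_imp_norm_closed
  by (auto simp: submodule_def finite_codim_def)

lemma component_mem: "F \<in> T \<Longrightarrow> (\<lambda>z. F z $ i) \<in> H"
  by (auto simp: tensor_Cn_def)

lemma T_outside: "F \<in> T \<Longrightarrow> z \<notin> \<Omega> \<Longrightarrow> F z = 0"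
  using zero_outside[OF component_mem] by (auto simp: vec_eq_iff)

lemma T_nrm_sq: "F \<in> T \<Longrightarrow> (T.nrm F)\<^sup>2 = (\<Sum>i\<in>UNIV. (H.nrm (\<lambda>z. F z $ i))\<^sup>2)"
  by (rule ip_norm_tensor[OF hilbert])

definition kernel_at :: "complex ^ 'd \<Rightarrow> complex ^ 'd \<Rightarrow> complex"
  where "kernel_at w = zero_ext \<Omega> (\<lambda>z. \<KK> z w)"

lemma kernel_at_mem: "w \<in> \<Omega> \<Longrightarrow> kernel_at w \<in> H"
  unfolding kernel_at_def by (rule kernel_mem)

lemma eval_eq: "f \<in> H \<Longrightarrow> w \<in> \<Omega> \<Longrightarrow> f w = ip f (kernel_at w)"
  unfolding kernel_at_def by (rule reproducing)

lemma kernel_at_self: "w \<in> \<Omega> \<Longrightarrow> kernel_at w w = of_real ((H.nrm (kernel_at w))\<^sup>2)"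
  using eval_eq[OF kernel_at_mem] H.ip_self[OF kernel_at_mem] by simp

lemma kernel_at_nrm_sq: "w \<in> \<Omega> \<Longrightarrow> (H.nrm (kernel_at w))\<^sup>2 = Re (\<KK> w w)"
  using kernel_at_self[of w] by (simp add: kernel_at_def zero_ext_def del: of_real_power)

lemma eval_bound: "f \<in> H \<Longrightarrow> w \<in> \<Omega> \<Longrightarrow> cmod (f w) \<le> H.nrm f * H.nrm (kernel_at w)"
  using H.cauchy_schwarz[OF _ kernel_at_mem] eval_eq by metis

lemma eval_bound_T:
  assumes F: "F \<in> T" and w: "w \<in> \<Omega>"
  shows "norm (F w) \<le> T.nrm F * H.nrm (kernel_at w)"
proof -
  have "(norm (F w))\<^sup>2 = (\<Sum>i\<in>UNIV. (cmod (F w $ i))\<^sup>2)"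
    by (simp add: norm_vec_def L2_set_def sum_nonneg)
  also have "\<dots> \<le> (\<Sum>i\<in>UNIV. (H.nrm (\<lambda>z. F z $ i) * H.nrm (kernel_at w))\<^sup>2)"
    using eval_bound[OF component_mem[OF F] w] by (intro sum_mono power_mono) auto
  also have "\<dots> = (T.nrm F * H.nrm (kernel_at w))\<^sup>2"
    by (simp add: power_mult_distrib T_nrm_sq[OF F] sum_distrib_right)
  finally show ?thesis
    by (rule power2_le_imp_le) (use F w in \<open>simp add: kernel_at_mem\<close>)
qed

lemma polynomial_approx:
  assumes "f \<in> H" "r > 0"
  obtains p where "p \<in> polynomials \<Omega>" "H.nrm (f - p) < r"
  using assms H.closure_iff[OF polynomials_sub, of f] polynomials_dense by blast

lemma polynomials_bounded:
  assumes "p \<in> polynomials \<Omega>"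
  shows "\<exists>C. \<forall>z. cmod (p z) \<le> C"
  using assms unfolding polynomials_def
proof (induction rule: cfun.span_induct_alt)
  case base
  then show ?case by auto
next
  case (step c x y)
  then obtain C \<alpha> where C: "\<And>z. cmod (y z) \<le> C"
    and x: "x = zero_ext \<Omega> (\<lambda>z. \<Prod>j\<in>UNIV. z $ j ^ \<alpha> j)" by blast
  obtain b where b: "\<And>z. z \<in> \<Omega> \<Longrightarrow> norm z \<le> b" "b > 0"
    using bounded_domain by (auto simp: bounded_pos)
  have "cmod (x z) \<le> (\<Prod>j\<in>UNIV. b ^ \<alpha> j)" for z
  proof (cases "z \<in> \<Omega>")
    case True
    have "cmod (z $ j) \<le> b" for j using Finite_Cartesian_Product.norm_nth_le[of z j] b(1)[OF True] by simp
    then show ?thesis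
      using True by (simp add: x zero_ext_def prod_norm[symmetric] norm_power prod_mono power_mono)
  next
    case False
    then show ?thesis using b(2) by (simp add: x zero_ext_def prod_nonneg)
  qed
  then have "cmod ((cscale c x + y) z) \<le> cmod c * (\<Prod>j\<in>UNIV. b ^ \<alpha> j) + C" for z
    unfolding cscale_def plus_fun_apply
    by (intro order_trans[OF norm_triangle_ineq] add_mono C) (simp add: norm_mult mult_left_mono)
  then show ?case by blast
qed

lemma kernel_at_large: "eventually (\<lambda>z. R < H.nrm (kernel_at z)) (boundary_filter \<Omega>)"
proof -
  have "eventually (\<lambda>z. \<bar>R\<bar>\<^sup>2 < Re (\<KK> z z)) (boundary_filter \<Omega>)"
    using kernel_blowup unfolding eventually_boundary_filter tends_to_infinity_at_boundary_def by blast
  with eventually_boundary_filter_mem show ?thesis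
  proof eventually_elim
    case (elim z)
    then have "\<bar>R\<bar>\<^sup>2 < (H.nrm (kernel_at z))\<^sup>2" by (simp only: kernel_at_nrm_sq)
    then have "\<bar>R\<bar> < H.nrm (kernel_at z)"
      by (rule power2_less_imp_less) (use elim in \<open>simp add: kernel_at_mem\<close>)
    then show ?case by linarith
  qed
qed

text \<open>The normalised kernel vectors converge weakly to zero at the boundary: this is clear
  against polynomials, which are bounded on \<open>\<Omega>\<close>, and these are dense.\<close>

lemma eval_small_at_boundary:
  assumes f: "f \<in> H" and e: "e > 0"
  shows "eventually (\<lambda>z. cmod (f z) \<le> e * H.nrm (kernel_at z)) (boundary_filter \<Omega>)"
proof -
  obtain p where p: "p \<in> polynomials \<Omega>" "H.nrm (f - p) < e / 2"
    using polynomial_approx[OF f, of "e / 2"] e by auto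
  obtain C where C: "\<And>z. cmod (p z) \<le> C" using polynomials_bounded[OF p(1)] by blast
  have "p \<in> H" using p polynomials_sub by blast
  show ?thesis
    using eventually_boundary_filter_mem kernel_at_large[of "2 * C / e"]
  proof eventually_elim
    case (elim z)
    have "cmod (f z) \<le> cmod (p z) + cmod ((f - p) z)"
      using norm_triangle_ineq[of "p z" "(f - p) z"] by simp
    also have "cmod ((f - p) z) \<le> H.nrm (f - p) * H.nrm (kernel_at z)"
      using f \<open>p \<in> H\<close> elim(1) by (intro eval_bound H.S_mem)
    also have "\<dots> \<le> e / 2 * H.nrm (kernel_at z)"
      using p elim(1) by (intro mult_right_mono) (auto simp: kernel_at_mem)
    also have "cmod (p z) \<le> e / 2 * H.nrm (kernel_at z)"
      using C[of z] elim(2) e by (simp add: field_simps)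
    finally show ?case by simp
  qed
qed

lemma elem_tensor_mem:
  assumes "f \<in> H" shows "elem_tensor f v \<in> T"
proof -
  have "cscale (v $ i) f \<in> H" for i using assms by simp
  then show ?thesis by (simp add: tensor_Cn_def elem_tensor_def cscale_def mult.commute)
qed

lemma T_ip_elem_tensor:
  assumes F: "F \<in> T" and w: "w \<in> \<Omega>"
  shows "tip F (elem_tensor (kernel_at w) v) = hprod (F w) v"
proof -
  have "ip (\<lambda>z. F z $ i) (\<lambda>z. elem_tensor (kernel_at w) v z $ i) = F w $ i * cnj (v $ i)" for i
  proof -
    have "(\<lambda>z. elem_tensor (kernel_at w) v z $ i) = cscale (v $ i) (kernel_at w)"
      by (simp add: elem_tensor_def cscale_def mult.commute)
    then show ?thesis
      using H.ip_smul_right[OF component_mem[OF F] kernel_at_mem[OF w]] eval_eq[OF component_mem[OF F] w]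
      by simp
  qed
  then show ?thesis by (simp add: tensor_ip_def hprod_def)
qed

lemma T_nrm_elem_tensor:
  assumes "f \<in> H"
  shows "T.nrm (elem_tensor f v) = H.nrm f * norm v"
proof -
  have c: "(\<lambda>z. elem_tensor f v z $ i) = cscale (v $ i) f" for i
    by (simp add: elem_tensor_def cscale_def mult.commute)
  have "(T.nrm (elem_tensor f v))\<^sup>2 = (\<Sum>i\<in>UNIV. (cmod (v $ i) * H.nrm f)\<^sup>2)"
    unfolding T_nrm_sq[OF elem_tensor_mem[OF assms]] c using assms by (simp add: H.nrm_smul)
  also have "\<dots> = (H.nrm f * norm v)\<^sup>2"
    by (simp add: power_mult_distrib norm_vec_def L2_set_def sum_nonneg sum_distrib_left mult.commute)
  finally show ?thesis
    using assms elem_tensor_mem by (simp add: power2_eq_iff_nonneg)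
qed

text \<open>The weak limit passes to the finitely many vectors that measure the distance to \<open>M\<close>.\<close>

lemma kernel_near_M:
  assumes e: "e > 0"
  shows "eventually (\<lambda>z. \<forall>v. \<exists>G\<in>M. T.nrm (elem_tensor (kernel_at z) v - G)
    \<le> e * H.nrm (kernel_at z) * norm v) (boundary_filter \<Omega>)"
proof -
  obtain B where B: "finite B" "B \<subseteq> T" "\<And>F. F \<in> T \<Longrightarrow> \<exists>G\<in>M. F - G \<in> vfun.span B"
    using finite_codim_M unfolding finite_codim_def by blast
  obtain E C where E: "finite E" "E \<subseteq> T" "0 \<le> C"
    and approx: "\<And>F. F \<in> T \<Longrightarrow> \<exists>G\<in>M. T.nrm (F - G) \<le> C * (\<Sum>K\<in>E. cmod (tip F K))"
    using T.finite_codim_approx[OF B(1,2) M_subspace M_closed B(3)] by blast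
  \<comment> \<open>bounding all components of all members of \<open>E\<close> by \<open>e'\<close> costs the factor \<open>C * c\<close>; the
    summand 1 keeps the denominator of \<open>e'\<close> positive\<close>
  define c where "c = real (card E) * real CARD('n)"
  define e' where "e' = e / (C * c + 1)"
  have c: "C * c \<ge> 0" using E by (simp add: c_def)
  have e': "e' > 0" "C * c * e' \<le> e" using e c by (auto simp: e'_def field_simps add_pos_nonneg)
  have "eventually (\<lambda>z. cmod (K z $ i) \<le> e' * H.nrm (kernel_at z)) (boundary_filter \<Omega>)" if "K \<in> E" for K i
    using eval_small_at_boundary[OF component_mem e'(1)] that E by blast
  then have "eventually (\<lambda>z. \<forall>K\<in>E. \<forall>i. cmod (K z $ i) \<le> e' * H.nrm (kernel_at z)) (boundary_filter \<Omega>)"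
    using E(1) by (auto intro!: eventually_ball_finite eventually_all_finite)
  with eventually_boundary_filter_mem show ?thesis
  proof eventually_elim
    case (elim z)
    let ?k = "H.nrm (kernel_at z)"
    show ?case
    proof
      fix v :: "complex ^ 'n"
      let ?F = "elem_tensor (kernel_at z) v"
      have F: "?F \<in> T" using elim(1) by (intro elem_tensor_mem kernel_at_mem)
      have "cmod (tip ?F K) \<le> real CARD('n) * (e' * ?k) * norm v" if K: "K \<in> E" for K
      proof -
        have KT: "K \<in> T" using K E by blast
        have "cmod (tip ?F K) = cmod (hprod (K z) v)"
          using T.ip_cnj[OF KT F] T_ip_elem_tensor[OF KT elim(1)] by simp
        also have "\<dots> \<le> norm (K z) * norm v" by (rule cmod_hprod_le)
        also have "norm (K z) \<le> (\<Sum>i\<in>UNIV. cmod (K z $ i))"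
          unfolding norm_vec_def by (rule L2_set_le_sum) auto
        also have "\<dots> \<le> (\<Sum>i\<in>(UNIV::'n set). e' * ?k)"
          using elim(2) K by (intro sum_mono) auto
        finally show ?thesis by (simp add: mult_right_mono)
      qed
      then have "(\<Sum>K\<in>E. cmod (tip ?F K)) \<le> (\<Sum>K\<in>E. real CARD('n) * (e' * ?k) * norm v)"
        by (rule sum_mono)
      also have "\<dots> = c * e' * ?k * norm v" by (simp add: c_def)
      finally have "C * (\<Sum>K\<in>E. cmod (tip ?F K)) \<le> C * (c * e' * ?k * norm v)"
        using E(3) by (rule mult_left_mono)
      also have "\<dots> = (C * c * e') * (?k * norm v)" by simp
      also have "\<dots> \<le> e * (?k * norm v)"
        using e'(2) elim(1) by (intro mult_right_mono) (auto simp: kernel_at_mem)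
      finally have "C * (\<Sum>K\<in>E. cmod (tip ?F K)) \<le> e * ?k * norm v" by simp
      then show "\<exists>G\<in>M. T.nrm (?F - G) \<le> e * ?k * norm v"
        using approx[OF F] order_trans by blast
    qed
  qed
qed

lemma U_nrm: "F \<in> M \<Longrightarrow> T.nrm (U F) = T.nrm F"
  using U_isometric[of F F] by (simp add: ip_norm_def)

text \<open>Let \<open>k\<close> be the norm of the kernel function at \<open>z\<close>, and let \<open>G \<in> M\<close> be close to that
  function times \<open>x\<close>.  Then \<open>\<parallel>G\<parallel>\<close> is about \<open>k \<parallel>x\<parallel>\<close>, so \<open>A G(z) = (U G)(z)\<close> is bounded by about
  \<open>k\<^sup>2 \<parallel>x\<parallel>\<close>, while \<open>G(z)\<close> is about \<open>k\<^sup>2 x\<close>.  The error in the latter is multiplied by \<open>\<parallel>A\<parallel>\<close>,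
  which is unknown but finite: the resulting inequality \<open>\<parallel>A\<parallel> \<le> (1 + e) + \<parallel>A\<parallel> e\<close> can be solved
  for \<open>\<parallel>A\<parallel>\<close>.\<close>

lemma local_matrix_bound:
  assumes r: "r > 1"
  shows "eventually (\<lambda>z. \<forall>A. (\<forall>F\<in>M. U F z = A *v F z) \<longrightarrow> (\<forall>u. norm (A *v u) \<le> r * norm u))
    (boundary_filter \<Omega>)"
proof -
  \<comment> \<open>chosen so that \<open>(1 + e) / (1 - e) = r\<close>\<close>
  define e where "e = (r - 1) / (r + 1)"
  have e: "e > 0" "e < 1" "1 + e = r * (1 - e)" using r by (auto simp: e_def field_simps)
  show ?thesis
    using eventually_boundary_filter_mem kernel_at_large[of 0] kernel_near_M[OF e(1)]
  proof eventually_elim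
    case (elim z)
    note z = elim(1)
    let ?k = "H.nrm (kernel_at z)"
    show ?case
    proof (intro allI impI)
      fix A and u :: "complex ^ 'n"
      assume A: "\<forall>F\<in>M. U F z = A *v F z"
      let ?N = "onorm ((*v) A)"
      have N: "norm (A *v x) \<le> ?N * norm x" for x by (rule onorm) simp
      have N0: "0 \<le> ?N" by (rule onorm_pos_le) simp
      have "norm (A *v x) \<le> ((1 + e) + ?N * e) * norm x" for x
      proof -
        let ?F = "elem_tensor (kernel_at z) x"
        obtain G where G: "G \<in> M" and FG: "T.nrm (?F - G) \<le> e * ?k * norm x"
          using elim(3) by blast
        have FT: "?F \<in> T" and GT: "G \<in> T" using z G M_sub by (auto intro: elem_tensor_mem kernel_at_mem)
        have "T.nrm G \<le> T.nrm ?F + T.nrm (?F - G)"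
          using T.nrm_diff_triangle[OF GT FT T.S_mem(1)] T.nrm_minus_commute[OF GT FT] by simp
        also have "\<dots> \<le> (1 + e) * ?k * norm x"
          using FG z by (simp add: T_nrm_elem_tensor kernel_at_mem algebra_simps)
        finally have nG: "T.nrm G \<le> (1 + e) * ?k * norm x" .
        have "norm (U G z) \<le> T.nrm G * ?k"
          using eval_bound_T[OF U_mem[OF G] z] U_nrm[OF G] by simp
        also have "\<dots> \<le> ((1 + e) * ?k * norm x) * ?k"
          using nG elim(2) by (intro mult_right_mono) auto
        finally have 1: "norm (A *v G z) \<le> ((1 + e) * ?k * norm x) * ?k" using A G by simp
        have "norm (?F z - G z) \<le> T.nrm (?F - G) * ?k"
          using eval_bound_T[of "?F - G" z] FT GT z by simp
        also have "\<dots> \<le> (e * ?k * norm x) * ?k" using FG elim(2) by (intro mult_right_mono) auto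
        finally have "norm (A *v (?F z - G z)) \<le> ?N * ((e * ?k * norm x) * ?k)"
          using N[of "?F z - G z"] N0 by (meson mult_left_mono order_trans)
        with 1 have "norm (A *v G z + A *v (?F z - G z))
            \<le> ((1 + e) * ?k * norm x) * ?k + ?N * ((e * ?k * norm x) * ?k)"
          by (intro norm_triangle_mono)
        also have "A *v G z + A *v (?F z - G z) = of_real (?k\<^sup>2) *s (A *v x)"
          using z by (simp add: elem_tensor_def kernel_at_self matrix_vector_right_distrib[symmetric]
              vector_scalar_commute)
        finally have "?k\<^sup>2 * norm (A *v x) \<le> ?k\<^sup>2 * (((1 + e) + ?N * e) * norm x)"
          by (simp add: norm_scale_vec power2_eq_square algebra_simps norm_mult)
        then show ?thesis using elim(2) by simp
      qed
      then have "?N \<le> (1 + e) + ?N * e" by (rule onorm_le)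
      then have "(1 - e) * ?N \<le> (1 - e) * r" using e(3) by (simp add: algebra_simps)
      then have "?N \<le> r" using e(2) by simp
      then show "norm (A *v u) \<le> r * norm u"
        using N[of u] by (meson mult_right_mono norm_ge_zero order_trans)
    qed
  qed
qed

section \<open>Module maps act by multiplication\<close>

abbreviation const_fun :: "complex ^ 'n \<Rightarrow> complex ^ 'd \<Rightarrow> complex ^ 'n"
  where "const_fun v \<equiv> elem_tensor (zero_ext \<Omega> (\<lambda>_. 1)) v"

lemma one_mem: "zero_ext \<Omega> (\<lambda>_. 1) \<in> H"
proof -
  have "zero_ext \<Omega> (\<lambda>z. \<Prod>j\<in>UNIV. z $ j ^ 0) \<in> polynomials \<Omega>"
    unfolding polynomials_def by (intro cfun.span_base range_eqI[of _ _ "\<lambda>_. 0"]) simp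
  then show ?thesis using polynomials_sub by auto
qed

lemma const_fun_mem: "const_fun v \<in> T"
  by (intro elem_tensor_mem one_mem)

lemma T_coord: "coord_mult_tensor j ` T \<subseteq> T"
proof
  fix F assume "F \<in> coord_mult_tensor j ` T"
  then obtain G where G: "G \<in> T" and F: "F = coord_mult_tensor j G" by blast
  have "coord_mult j (\<lambda>z. G z $ i) \<in> H" for i
    using coord_mult_bounded[of j] component_mem[OF G, of i] unfolding bounded_on_def by blast
  then show "F \<in> T" by (simp add: F tensor_Cn_def coord_mult_tensor_def coord_mult_def)
qed

lemma coord_mult_tensor_bounded: "\<exists>C\<ge>0. \<forall>F\<in>T. T.nrm (coord_mult_tensor j F) \<le> C * T.nrm F"
proof -
  obtain C where C: "\<And>f. f \<in> H \<Longrightarrow> H.nrm (coord_mult j f) \<le> C * H.nrm f"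
    using coord_mult_bounded[of j] unfolding bounded_on_def by blast
  have "T.nrm (coord_mult_tensor j F) \<le> \<bar>C\<bar> * T.nrm F" if F: "F \<in> T" for F
  proof -
    have zF: "coord_mult_tensor j F \<in> T" using T_coord F by blast
    have mem: "coord_mult j (\<lambda>z. F z $ i) \<in> H" for i
      using coord_mult_bounded[of j] component_mem[OF F, of i] unfolding bounded_on_def by blast
    have "(T.nrm (coord_mult_tensor j F))\<^sup>2 = (\<Sum>i\<in>UNIV. (H.nrm (coord_mult j (\<lambda>z. F z $ i)))\<^sup>2)"
      unfolding T_nrm_sq[OF zF] by (simp add: coord_mult_tensor_def coord_mult_def)
    also have "\<dots> \<le> (\<Sum>i\<in>UNIV. (\<bar>C\<bar> * H.nrm (\<lambda>z. F z $ i))\<^sup>2)"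
    proof (intro sum_mono power_mono)
      fix i
      have "C * H.nrm (\<lambda>z. F z $ i) \<le> \<bar>C\<bar> * H.nrm (\<lambda>z. F z $ i)"
        using component_mem[OF F] by (intro mult_right_mono) auto
      then show "H.nrm (coord_mult j (\<lambda>z. F z $ i)) \<le> \<bar>C\<bar> * H.nrm (\<lambda>z. F z $ i)"
        using C[OF component_mem[OF F, of i]] by linarith
    qed (use mem in auto)
    also have "\<dots> = (\<bar>C\<bar> * T.nrm F)\<^sup>2"
      by (simp add: power_mult_distrib T_nrm_sq[OF F] sum_distrib_left)
    finally show ?thesis by (rule power2_le_imp_le) (use F in simp)
  qed
  then show ?thesis by (intro exI[of _ "\<bar>C\<bar>"]) auto
qed

lemma poly_mult_bounded: "\<exists>C\<ge>0. \<forall>F\<in>T. T.nrm (poly_mult j p F) \<le> C * T.nrm F"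
proof (induction p)
  case 0
  show ?case unfolding poly_mult_zero_poly T.nrm_zero by (intro exI[of _ 0]) simp
next
  case (pCons a p)
  obtain C where C: "C \<ge> 0" "\<And>F. F \<in> T \<Longrightarrow> T.nrm (poly_mult j p F) \<le> C * T.nrm F"
    using pCons.IH by blast
  obtain D where D: "D \<ge> 0" "\<And>F. F \<in> T \<Longrightarrow> T.nrm (coord_mult_tensor j F) \<le> D * T.nrm F"
    using coord_mult_tensor_bounded by blast
  have "T.nrm (poly_mult j (pCons a p) F) \<le> (cmod a + D * C) * T.nrm F" if F: "F \<in> T" for F
  proof -
    have pF: "poly_mult j p F \<in> T" by (rule poly_mult_mem[OF T.subspace_S T_coord F])
    have zpF: "coord_mult_tensor j (poly_mult j p F) \<in> T" using T_coord pF by blast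
    have "T.nrm (poly_mult j (pCons a p) F) \<le> T.nrm (vscale a F) + T.nrm (coord_mult_tensor j (poly_mult j p F))"
      unfolding poly_mult_pCons using F zpF by (intro T.nrm_triangle) auto
    also have "\<dots> \<le> cmod a * T.nrm F + D * (C * T.nrm F)"
      using D C(2)[OF F] F D(2)[OF pF] by (intro add_mono) (auto simp: T.nrm_smul intro: order_trans mult_left_mono)
    finally show ?thesis by (simp add: algebra_simps)
  qed
  then show ?case using C D by (intro exI[of _ "cmod a + D * C"]) auto
qed

lemma monomial_times:
  fixes V :: "(complex ^ 'd \<Rightarrow> complex ^ 'n) \<Rightarrow> complex ^ 'd \<Rightarrow> complex ^ 'n"
  assumes V: "\<And>F. F \<in> T \<Longrightarrow> V F \<in> T" "\<And>F G. F \<in> T \<Longrightarrow> G \<in> T \<Longrightarrow> V (F + G) = V F + V G"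
      "\<And>c F. F \<in> T \<Longrightarrow> V (vscale c F) = vscale c (V F)"
      "\<And>j F. F \<in> T \<Longrightarrow> V (coord_mult_tensor j F) = coord_mult_tensor j (V F)"
    and F: "F \<in> T"
  shows "(\<lambda>z. (\<Prod>j\<in>J. z $ j ^ \<alpha> j) *s F z) \<in> T \<and>
    V (\<lambda>z. (\<Prod>j\<in>J. z $ j ^ \<alpha> j) *s F z) = (\<lambda>z. (\<Prod>j\<in>J. z $ j ^ \<alpha> j) *s V F z)"
proof (induction J rule: infinite_finite_induct)
  case (insert j J)
  have pow: "(\<lambda>z. z $ j ^ n *s G z) \<in> T \<and> V (\<lambda>z. z $ j ^ n *s G z) = (\<lambda>z. z $ j ^ n *s V G z)"
    if G: "G \<in> T" for G n
  proof (induction n)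
    case (Suc n)
    have step: "(\<lambda>z. z $ j ^ Suc n *s G z) = coord_mult_tensor j (\<lambda>z. z $ j ^ n *s G z)"
      for G :: "complex ^ 'd \<Rightarrow> complex ^ 'n"
      by (simp add: coord_mult_tensor_def)
    show ?case
      unfolding step using Suc V(4)[of "\<lambda>z. z $ j ^ n *s G z" j] T_coord by auto
  qed (use G in simp)
  have "(\<lambda>z. (\<Prod>j\<in>insert j J. z $ j ^ \<alpha> j) *s G z) = (\<lambda>z. z $ j ^ \<alpha> j *s ((\<Prod>j\<in>J. z $ j ^ \<alpha> j) *s G z))"
    for G :: "complex ^ 'd \<Rightarrow> complex ^ 'n" using insert.hyps by simp
  then show ?case using pow[of "\<lambda>z. (\<Prod>j\<in>J. z $ j ^ \<alpha> j) *s F z" "\<alpha> j"] insert.IH by simp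
qed (use F in auto)

text \<open>So \<open>V\<close> is multiplication by the matrix whose columns are the images of the constant
  functions.  For polynomials this is the module property; both sides are continuous
  in \<open>F\<close>, since point evaluations are bounded, and the polynomials are dense.\<close>

lemma bounded_module_map_eq:
  assumes V: "\<And>F. F \<in> T \<Longrightarrow> V F \<in> T" "\<And>F G. F \<in> T \<Longrightarrow> G \<in> T \<Longrightarrow> V (F + G) = V F + V G"
      "\<And>c F. F \<in> T \<Longrightarrow> V (vscale c F) = vscale c (V F)"
      "\<And>j F. F \<in> T \<Longrightarrow> V (coord_mult_tensor j F) = coord_mult_tensor j (V F)"
    and bounded: "\<And>F. F \<in> T \<Longrightarrow> T.nrm (V F) \<le> C * T.nrm F"
    and F: "F \<in> T" and z: "z \<in> \<Omega>"
  shows "V F z = (\<Sum>i\<in>UNIV. F z $ i *s V (const_fun (axis i 1)) z)"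
proof -
  have V0: "V 0 = 0" using V(3)[OF T.S_mem(1), of 0] by (simp only: vfun.scale_zero_left)
  have elem_add: "elem_tensor (f + g) v = elem_tensor f v + elem_tensor g v"
    and elem_scale: "elem_tensor (cscale c f) v = vscale c (elem_tensor f v)"
    for f g :: "complex ^ 'd \<Rightarrow> complex" and c and v :: "complex ^ 'n"
    by (simp_all add: elem_tensor_def cscale_def vscale_def fun_eq_iff vec_eq_iff algebra_simps)
  have poly: "p \<in> H \<and> V (elem_tensor p v) z = p z *s V (const_fun v) z" if "p \<in> polynomials \<Omega>" for p v
    using that unfolding polynomials_def
  proof (induction rule: cfun.span_induct_alt)
    case base
    have "elem_tensor 0 v = vscale 0 (const_fun v)"
      by (simp add: elem_tensor_def vscale_def fun_eq_iff)
    then have "elem_tensor 0 v = (0 :: complex ^ 'd \<Rightarrow> complex ^ 'n)" by simp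
    then have "V (elem_tensor 0 v) z = 0 z *s V (const_fun v) z"
      by (simp only: V0 zero_fun_apply vector_smult_lzero)
    with H.S_mem(1) show "0 \<in> H \<and> V (elem_tensor 0 v) z = 0 z *s V (const_fun v) z" by (rule conjI)
  next
    case (step c x y)
    then obtain \<alpha> where x: "x = zero_ext \<Omega> (\<lambda>z. \<Prod>j\<in>UNIV. z $ j ^ \<alpha> j)" by blast
    have "x \<in> polynomials \<Omega>" unfolding polynomials_def x by (intro cfun.span_base) blast
    then have xH: "x \<in> H" using polynomials_sub by blast
    have "elem_tensor x v = (\<lambda>z. (\<Prod>j\<in>UNIV. z $ j ^ \<alpha> j) *s const_fun v z)"
      by (simp add: elem_tensor_def x zero_ext_def fun_eq_iff)
    then have "V (elem_tensor x v) z = x z *s V (const_fun v) z"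
      using monomial_times[of V "const_fun v" \<alpha> UNIV, OF V const_fun_mem] z by (simp add: x zero_ext_def)
    moreover have "V (elem_tensor (cscale c x + y) v) = vscale c (V (elem_tensor x v)) + V (elem_tensor y v)"
      unfolding elem_add elem_scale using xH step.IH
      by (subst V(2)) (auto simp: V(3) elem_tensor_mem)
    ultimately have "V (elem_tensor (cscale c x + y) v) z = (cscale c x + y) z *s V (const_fun v) z"
      using step.IH by (simp only: plus_fun_apply) (simp add: cscale_def vscale_def vec_eq_iff algebra_simps)
    moreover have "cscale c x + y \<in> H" using xH step.IH by (intro H.S_mem) auto
    ultimately show "cscale c x + y \<in> H \<and>
        V (elem_tensor (cscale c x + y) v) z = (cscale c x + y) z *s V (const_fun v) z" by blast
  qed
  have elem: "V (elem_tensor f v) z = f z *s V (const_fun v) z" if f: "f \<in> H" for f v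
  proof -
    \<comment> \<open>a bound for the functional that sends \<open>f\<close> to the difference of the two sides\<close>
    define K where "K = \<bar>C\<bar> * norm v * H.nrm (kernel_at z) + H.nrm (kernel_at z) * norm (V (const_fun v) z)"
    have K: "K \<ge> 0" using z by (simp add: K_def kernel_at_mem)
    have "norm (V (elem_tensor f v) z - f z *s V (const_fun v) z) \<le> 0 + e" if "e > 0" for e
    proof -
      obtain p where p: "p \<in> polynomials \<Omega>" "H.nrm (f - p) < e / (K + 1)"
        using polynomial_approx[OF f, of "e / (K + 1)"] \<open>e > 0\<close> K by (auto simp: add_nonneg_pos)
      have pH: "p \<in> H" using p polynomials_sub by blast
      define g where "g = f - p"
      have g: "g \<in> H" unfolding g_def using f pH by (rule H.S_mem)
      have fg: "f = p + g" unfolding g_def by (simp add: algebra_simps)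
      have k: "0 \<le> H.nrm (kernel_at z)" using z by (simp add: kernel_at_mem)
      have "V (elem_tensor f v) = V (elem_tensor p v) + V (elem_tensor g v)"
        unfolding fg elem_add using pH g by (intro V elem_tensor_mem)
      then have split: "V (elem_tensor f v) z - f z *s V (const_fun v) z
          = V (elem_tensor g v) z - g z *s V (const_fun v) z"
        using poly[OF p(1), of v] by (simp add: fg vec_eq_iff algebra_simps)
      have "T.nrm (V (elem_tensor g v)) \<le> C * (H.nrm g * norm v)"
        using bounded[OF elem_tensor_mem[OF g], of v] T_nrm_elem_tensor[OF g, of v] by simp
      also have "\<dots> \<le> \<bar>C\<bar> * (H.nrm g * norm v)" using g by (intro mult_right_mono) auto
      finally have "T.nrm (V (elem_tensor g v)) * H.nrm (kernel_at z)
          \<le> \<bar>C\<bar> * (H.nrm g * norm v) * H.nrm (kernel_at z)"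
        using k by (rule mult_right_mono)
      moreover have "norm (V (elem_tensor g v) z) \<le> T.nrm (V (elem_tensor g v)) * H.nrm (kernel_at z)"
        using g z by (intro eval_bound_T V elem_tensor_mem)
      moreover have "norm (g z *s V (const_fun v) z) \<le> (H.nrm g * H.nrm (kernel_at z)) * norm (V (const_fun v) z)"
        unfolding norm_scale_vec using eval_bound[OF g z] by (intro mult_right_mono) auto
      ultimately have "norm (V (elem_tensor f v) z - f z *s V (const_fun v) z)
          \<le> \<bar>C\<bar> * (H.nrm g * norm v) * H.nrm (kernel_at z)
            + (H.nrm g * H.nrm (kernel_at z)) * norm (V (const_fun v) z)"
        unfolding split using norm_triangle_ineq4[of "V (elem_tensor g v) z" "g z *s V (const_fun v) z"]
        by linarith
      also have "\<dots> = K * H.nrm g" by (simp add: K_def algebra_simps)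
      also have "\<dots> \<le> K * (e / (K + 1))"
        using p(2) K unfolding g_def[symmetric] by (intro mult_left_mono) auto
      also have "\<dots> \<le> e" using K \<open>e > 0\<close> by (simp add: field_simps)
      finally show ?thesis by simp
    qed
    then have "norm (V (elem_tensor f v) z - f z *s V (const_fun v) z) \<le> 0"
      by (rule field_le_epsilon)
    then show ?thesis by simp
  qed
  have V_sum: "V (sum f I) z = (\<Sum>i\<in>I. V (f i) z)" if f: "\<And>i. f i \<in> T" for f and I :: "'n set"
    using finite[of I]
  proof (induction I rule: finite_induct)
    case empty
    have "V (sum f {}) = 0" unfolding sum.empty by (rule V0)
    then show ?case by (metis sum.empty zero_fun_apply)
  next
    case (insert i I)
    have eq: "V (sum f (insert i I)) = V (f i) + V (sum f I)"
      unfolding sum.insert[OF insert.hyps] by (intro V f T.S_sum)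
    have "V (sum f (insert i I)) z = V (f i) z + (\<Sum>i\<in>I. V (f i) z)"
      unfolding eq insert.IH[symmetric] by (rule plus_fun_apply)
    also have "\<dots> = (\<Sum>i\<in>insert i I. V (f i) z)" by (rule sum.insert[OF insert.hyps, symmetric])
    finally show ?case .
  qed
  have sum_apply: "(\<Sum>i\<in>I. elem_tensor (\<lambda>z. F z $ i) (axis i 1)) x = (\<Sum>i\<in>I. F x $ i *s axis i 1)" for x and I :: "'n set"
    by (induction I rule: infinite_finite_induct) (auto simp: elem_tensor_def)
  have "F = (\<Sum>i\<in>UNIV. elem_tensor (\<lambda>z. F z $ i) (axis i 1))"
    by (rule ext) (simp add: sum_apply basis_expansion)
  then have "V F z = (\<Sum>i\<in>UNIV. V (elem_tensor (\<lambda>z. F z $ i) (axis i 1)) z)"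
    using V_sum[of "\<lambda>i. elem_tensor (\<lambda>z. F z $ i) (axis i 1)" UNIV] elem_tensor_mem[OF component_mem[OF F]] by simp
  then show ?thesis using elem[OF component_mem[OF F]] by simp
qed

end

lemma poly_mult_coord: "poly_mult j p (coord_mult_tensor k F) = coord_mult_tensor k (poly_mult j p F)"
  by (simp add: poly_mult_def coord_mult_tensor_def fun_eq_iff vec_eq_iff)

lemma finite_common_zeros:
  fixes p :: "'d::finite \<Rightarrow> complex poly"
  assumes "\<And>j. p j \<noteq> 0"
  shows "finite {z :: complex ^ 'd. \<forall>j. poly (p j) (z $ j) = 0}"
proof (rule finite_subset)
  show "{z :: complex ^ 'd. \<forall>j. poly (p j) (z $ j) = 0} \<subseteq> vec_lambda ` (PiE UNIV (\<lambda>j. {x. poly (p j) x = 0}))"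
  proof
    fix z :: "complex ^ 'd" assume "z \<in> {z. \<forall>j. poly (p j) (z $ j) = 0}"
    then show "z \<in> vec_lambda ` (PiE UNIV (\<lambda>j. {x. poly (p j) x = 0}))"
      by (intro image_eqI[of _ _ "vec_nth z"]) auto
  qed
  show "finite (vec_lambda ` (PiE UNIV (\<lambda>j. {x. poly (p j) x = 0})))"
    using assms by (intro finite_imageI finite_PiE) (auto simp: poly_roots_finite)
qed

lemma bounded_linear_line: "bounded_linear (\<lambda>\<zeta>::complex. \<zeta> *s (b :: complex ^ 'd))"
  by (intro linear_conv_bounded_linear[THEN iffD1] linearI) (simp_all add: vec_eq_iff algebra_simps)

lemma holomorphic_on_line:
  assumes f: "holomorphic_Cn_on f \<Omega>"
  shows "(\<lambda>\<zeta>. f (a + \<zeta> *s b)) holomorphic_on {\<zeta>. a + \<zeta> *s b \<in> \<Omega>}"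
  unfolding holomorphic_on_def
proof
  fix x assume "x \<in> {\<zeta>. a + \<zeta> *s b \<in> \<Omega>}"
  then obtain D where D: "(f has_derivative D) (at (a + x *s b))" "\<And>c v. D (c *s v) = c * D v"
    using f unfolding holomorphic_Cn_on_def by blast
  have "((\<lambda>\<zeta>. a + \<zeta> *s b) has_derivative (\<lambda>\<zeta>. 0 + \<zeta> *s b)) (at x)"
    by (intro has_derivative_add has_derivative_const bounded_linear_imp_has_derivative bounded_linear_line)
  from has_derivative_compose[OF this D(1)]
  have "((\<lambda>\<zeta>. f (a + \<zeta> *s b)) has_derivative (\<lambda>\<zeta>. D b * \<zeta>)) (at x)"
    by (simp add: D(2) mult.commute)
  then have "((\<lambda>\<zeta>. f (a + \<zeta> *s b)) has_field_derivative D b) (at x)"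
    by (simp add: has_field_derivative_def)
  then show "(\<lambda>\<zeta>. f (a + \<zeta> *s b)) field_differentiable at x within {\<zeta>. a + \<zeta> *s b \<in> \<Omega>}"
    using field_differentiable_at_within field_differentiable_def by blast
qed

context module_embedding
begin

lemma U_zero: "U 0 = 0"
  using U_scale[OF vfun.subspace_0[OF M_subspace], of 0] by (simp only: vfun.scale_zero_left)

lemma U_poly_mult:
  assumes F: "F \<in> M"
  shows "U (poly_mult j p F) = poly_mult j p (U F)"
proof (induction p)
  case 0
  show ?case unfolding poly_mult_zero_poly by (rule U_zero)
next
  case (pCons a p)
  have pF: "poly_mult j p F \<in> M" by (rule poly_mult_mem[OF M_subspace M_coord F])
  have "U (poly_mult j (pCons a p) F) = U (vscale a F) + U (coord_mult_tensor j (poly_mult j p F))"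
    unfolding poly_mult_pCons
    using vfun.subspace_scale[OF M_subspace F] pF M_coord by (intro U_add) auto
  also have "\<dots> = poly_mult j (pCons a p) (U F)"
    unfolding poly_mult_pCons U_scale[OF F] U_coord[OF pF] pCons.IH ..
  finally show ?case .
qed

lemma const_fun_apply: "z \<in> \<Omega> \<Longrightarrow> const_fun v z = v"
  by (simp add: elem_tensor_def zero_ext_def)

text \<open>The matrix at \<open>z\<close> is built from one index \<open>j\<close> with \<open>p j\<close> nonzero at \<open>z\<^sub>j\<close>, by applying
  \<open>bounded_module_map_eq\<close> to \<open>F \<mapsto> U (p\<^sub>j(z\<^sub>j) F)\<close> and dividing.  It represents \<open>U\<close> at \<open>z\<close> on
  all of \<open>M\<close>, so the choice of \<open>j\<close> does not show in the conclusion.\<close>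

lemma exists_multiplier:
  obtains p :: "'d \<Rightarrow> complex poly" and \<Phi> where "\<And>j. p j \<noteq> 0"
    and "\<And>j F. F \<in> T \<Longrightarrow> poly_mult j (p j) F \<in> M"
    and "\<And>z j F. z \<in> \<Omega> \<Longrightarrow> poly (p j) (z $ j) \<noteq> 0 \<Longrightarrow> F \<in> M \<Longrightarrow> U F z = \<Phi> z *v F z"
proof -
  obtain B where B: "finite B" "B \<subseteq> T" "\<And>F. F \<in> T \<Longrightarrow> \<exists>G\<in>M. F - G \<in> vfun.span B"
    using finite_codim_M unfolding finite_codim_def by blast
  have "\<forall>j. \<exists>q. q \<noteq> 0 \<and> (\<forall>F\<in>T. poly_mult j q F \<in> M)"
  proof
    fix j
    show "\<exists>q. q \<noteq> 0 \<and> (\<forall>F\<in>T. poly_mult j q F \<in> M)"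
      by (rule annihilating_poly[OF M_subspace M_coord[of j] T.subspace_S T_coord B]) blast+
  qed
  from choice[OF this] obtain p where p: "\<And>j. p j \<noteq> 0" "\<And>j F. F \<in> T \<Longrightarrow> poly_mult j (p j) F \<in> M"
    by blast
  have "\<exists>A. \<forall>F\<in>M. U F z = A *v F z" if z: "z \<in> \<Omega>" and nz: "poly (p j) (z $ j) \<noteq> 0" for z j
  proof -
    define V where "V F = U (poly_mult j (p j) F)" for F
    let ?c = "poly (p j) (z $ j)"
    define A where "A = (\<chi> i k. V (const_fun (axis k 1)) z $ i / ?c)"
    obtain C where C: "\<And>F. F \<in> T \<Longrightarrow> T.nrm (poly_mult j (p j) F) \<le> C * T.nrm F"
      using poly_mult_bounded by blast
    have "U F z = A *v F z" if F: "F \<in> M" for F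
    proof -
      have FT: "F \<in> T" using F M_sub by blast
      have "V F z = (\<Sum>k\<in>UNIV. F z $ k *s V (const_fun (axis k 1)) z)"
      proof (rule bounded_module_map_eq[OF _ _ _ _ _ FT z])
        show "V G \<in> T" if "G \<in> T" for G unfolding V_def by (intro U_mem p that)
        show "V (G + K) = V G + V K" if "G \<in> T" "K \<in> T" for G K
          unfolding V_def poly_mult_add by (intro U_add p that)
        show "V (vscale c G) = vscale c (V G)" if "G \<in> T" for c G
          unfolding V_def poly_mult_scale by (intro U_scale p that)
        show "V (coord_mult_tensor k G) = coord_mult_tensor k (V G)" if "G \<in> T" for k G
          unfolding V_def poly_mult_coord by (intro U_coord p that)
        show "T.nrm (V G) \<le> C * T.nrm G" if "G \<in> T" for G
          unfolding V_def U_nrm[OF p(2)[OF that]] by (rule C[OF that])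
      qed
      moreover have "V F z = ?c *s U F z"
        unfolding V_def U_poly_mult[OF F] by (simp add: poly_mult_def)
      ultimately have eq: "?c *s U F z = (\<Sum>k\<in>UNIV. F z $ k *s V (const_fun (axis k 1)) z)" by simp
      show ?thesis
      proof (rule vec_eq_iff[THEN iffD2, rule_format])
        fix i
        have "?c * U F z $ i = (\<Sum>k\<in>UNIV. F z $ k * V (const_fun (axis k 1)) z $ i)"
          using arg_cong[OF eq, of "\<lambda>v. v $ i"] by simp
        then have "U F z $ i = (\<Sum>k\<in>UNIV. F z $ k * V (const_fun (axis k 1)) z $ i) / ?c"
          using nz by (simp add: field_simps)
        then show "U F z $ i = (A *v F z) $ i"
          by (simp add: A_def matrix_vector_mult_def sum_divide_distrib mult.commute)
      qed
    qed
    then show ?thesis by blast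
  qed
  then have "\<forall>z. \<exists>A. z \<in> \<Omega> \<longrightarrow> (\<exists>j. poly (p j) (z $ j) \<noteq> 0) \<longrightarrow> (\<forall>F\<in>M. U F z = A *v F z)" by blast
  from choice[OF this] obtain \<Phi>
    where "\<And>z. z \<in> \<Omega> \<Longrightarrow> (\<exists>j. poly (p j) (z $ j) \<noteq> 0) \<Longrightarrow> (\<forall>F\<in>M. U F z = \<Phi> z *v F z)" by blast
  then show ?thesis using p by (intro that[of p \<Phi>]) blast+
qed

end

section \<open>Rigidity of the multiplier\<close>

locale module_multiplier = module_embedding \<Omega> H ip \<KK> M U
  for \<Omega> :: "(complex ^ 'd) set" and H ip \<KK>
    and M :: "(complex ^ 'd \<Rightarrow> complex ^ 'n) set" and U +
  fixes p :: "'d \<Rightarrow> complex poly" and \<Phi> :: "complex ^ 'd \<Rightarrow> complex ^ 'n ^ 'n"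
  assumes poly_annihilates: "F \<in> T \<Longrightarrow> poly_mult j (p j) F \<in> M"
    and multiplier: "z \<in> \<Omega> \<Longrightarrow> poly (p j) (z $ j) \<noteq> 0 \<Longrightarrow> F \<in> M \<Longrightarrow> U F z = \<Phi> z *v F z"
begin

text \<open>These elements of \<open>M\<close> let \<open>\<Phi>\<close> be read off: off the zeros of \<open>p j\<close> the image of
  \<open>test_fun j u\<close> under \<open>U\<close> is a nonzero multiple of \<open>\<Phi> z *v u\<close>, and it is holomorphic on
  all of \<open>\<Omega>\<close>.\<close>

definition test_fun :: "'d \<Rightarrow> complex ^ 'n \<Rightarrow> complex ^ 'd \<Rightarrow> complex ^ 'n"
  where "test_fun j u = poly_mult j (p j) (const_fun u)"

lemma test_fun_mem: "test_fun j u \<in> M"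
  unfolding test_fun_def by (intro poly_annihilates const_fun_mem)

lemma test_fun_apply: "z \<in> \<Omega> \<Longrightarrow> test_fun j u z = poly (p j) (z $ j) *s u"
  by (simp add: test_fun_def poly_mult_def const_fun_apply)

lemma U_test_fun:
  assumes "z \<in> \<Omega>" "poly (p j) (z $ j) \<noteq> 0"
  shows "U (test_fun j u) z = poly (p j) (z $ j) *s (\<Phi> z *v u)"
  using multiplier[OF assms test_fun_mem[of j u]] assms by (simp add: test_fun_apply vector_scalar_commute)

lemma U_holomorphic_on_line:
  assumes "F \<in> M"
  shows "(\<lambda>\<zeta>. hprod (U F (a + \<zeta> *s b)) v) holomorphic_on {\<zeta>. a + \<zeta> *s b \<in> \<Omega>}"
  unfolding hprod_def
  by (intro holomorphic_intros holomorphic_on_line holomorphic component_mem U_mem assms)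

text \<open>Along a complex line through \<open>z0\<close> on which the \<open>j\<close>-th coordinate is fixed, \<open>p j\<close> is a
  nonzero constant, so that \<open>\<Phi>\<close> has no poles there.  The maximum principle is applied on the
  compact set \<open>S\<close> of points of the slice at distance at least \<open>\<delta> / 2\<close> from the boundary of \<open>\<Omega>\<close>;
  its frontier lies in the zone where the boundary estimate is available.\<close>

lemma multiplier_contraction:
  assumes z0: "z0 \<in> \<Omega>" and nz: "poly (p j) (z0 $ j) \<noteq> 0"
  shows "norm (\<Phi> z0 *v u) \<le> norm u"
proof (rule field_le_epsilon)
  fix e :: real assume e: "e > 0"
  \<comment> \<open>close enough to 1 that \<open>r * norm u \<le> norm u + e\<close>\<close>
  define r where "r = 1 + e / (norm u + 1)"
  have r: "r > 1" "r * norm u \<le> norm u + e"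
  proof -
    have n: "0 < norm u + 1" by (simp add: add_nonneg_pos)
    then show "r > 1" using e by (simp add: r_def)
    have "e * (norm u / (norm u + 1)) \<le> e" using n e by (intro mult_left_le) auto
    then show "r * norm u \<le> norm u + e" by (simp add: r_def algebra_simps)
  qed
  obtain \<delta> where \<delta>: "\<delta> > 0" and near: "\<And>z A. z \<in> \<Omega> \<Longrightarrow> infdist z (frontier \<Omega>) < \<delta> \<Longrightarrow>
      (\<forall>F\<in>M. U F z = A *v F z) \<Longrightarrow> (\<forall>u. norm (A *v u) \<le> r * norm u)"
    using local_matrix_bound[OF r(1)] unfolding eventually_boundary_filter by blast
  have near: "norm (\<Phi> z *v u) \<le> r * norm u"
    if "z \<in> \<Omega>" "infdist z (frontier \<Omega>) < \<delta>" "z $ j = z0 $ j" for z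
    using near[OF that(1,2), of "\<Phi> z"] multiplier[of z j] that nz by auto
  have "norm (\<Phi> z0 *v u) \<le> r * norm u"
  proof (cases "infdist z0 (frontier \<Omega>) < \<delta>")
    case True
    then show ?thesis using near z0 by blast
  next
    case False
    then have ne: "frontier \<Omega> \<noteq> {}" using \<delta> by (auto simp: infdist_def)
    obtain k where k: "k \<noteq> j"
    proof (rule ccontr)
      assume "\<not> thesis"
      then have "UNIV = {j}" using that by blast
      then have "CARD('d) = 1" by (metis card_1_singleton_iff One_nat_def)
      then show False using two_coordinates by simp
    qed
    define h where "h \<zeta> = z0 + \<zeta> *s axis k 1" for \<zeta> :: complex
    have hj: "h \<zeta> $ j = z0 $ j" for \<zeta> using k by (simp add: h_def axis_def)
    have h0: "h 0 = z0" by (simp add: h_def)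
    have cont: "continuous_on UNIV h"
      unfolding h_def by (intro continuous_intros linear_continuous_on bounded_linear_line)
    define d where "d \<zeta> = infdist (h \<zeta>) (frontier \<Omega>)" for \<zeta>
    have contd: "continuous_on UNIV d" unfolding d_def by (intro continuous_on_infdist cont)
    define S where "S = {\<zeta>. h \<zeta> \<in> \<Omega> \<and> \<delta> / 2 \<le> d \<zeta>}"
    have hopen: "open {\<zeta>. h \<zeta> \<in> \<Omega>}"
      using open_vimage[OF open_domain cont] by (simp add: vimage_def)
    have "closed S"
    proof -
      have "h \<zeta> \<in> \<Omega>" if "h \<zeta> \<in> closure \<Omega>" "\<delta> / 2 \<le> d \<zeta>" for \<zeta>
        using that \<delta> open_domain by (cases "h \<zeta> \<in> frontier \<Omega>") (auto simp: d_def frontier_def interior_open)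
      then have eq: "S = (h -` closure \<Omega>) \<inter> {\<zeta>. \<delta> / 2 \<le> d \<zeta>}"
        using closure_subset[of \<Omega>] by (auto simp: S_def)
      show ?thesis
        unfolding eq by (intro closed_Int closed_vimage[OF closed_closure cont] closed_Collect_le contd continuous_on_const)
    qed
    have "bounded S"
    proof -
      obtain R where R: "\<And>z. z \<in> \<Omega> \<Longrightarrow> norm z \<le> R" using bounded_domain by (auto simp: bounded_iff)
      have "norm \<zeta> \<le> R + norm z0" if "\<zeta> \<in> S" for \<zeta>
      proof -
        have "norm ((h \<zeta> - z0) $ k) \<le> norm (h \<zeta> - z0)" by (rule Finite_Cartesian_Product.norm_nth_le)
        also have "\<dots> \<le> norm (h \<zeta>) + norm z0" by (rule norm_triangle_ineq4)
        finally show ?thesis using R[of "h \<zeta>"] that by (simp add: S_def h_def axis_def)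
      qed
      then show ?thesis by (auto simp: bounded_iff)
    qed
    define v where "v = \<Phi> z0 *v u"
    let ?c = "poly (p j) (z0 $ j)"
    define g where "g \<zeta> = hprod (U (test_fun j u) (h \<zeta>)) v" for \<zeta>
    have g_eq: "g \<zeta> = ?c * hprod (\<Phi> (h \<zeta>) *v u) v" if "h \<zeta> \<in> \<Omega>" for \<zeta>
      unfolding g_def using U_test_fun[OF that, of j u] nz by (simp add: hj hprod_scale_left)
    have g_hol: "g holomorphic_on {\<zeta>. h \<zeta> \<in> \<Omega>}"
      unfolding g_def h_def by (rule U_holomorphic_on_line[OF test_fun_mem])
    have SO: "S \<subseteq> {\<zeta>. h \<zeta> \<in> \<Omega>}" by (auto simp: S_def)
    have "cmod (g 0) \<le> cmod ?c * (r * norm u * norm v)"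
    proof (rule maximum_modulus_frontier[where f = g and S = S])
      show "g holomorphic_on interior S"
        using g_hol by (rule holomorphic_on_subset) (use SO interior_subset in blast)
      show "continuous_on (closure S) g"
        using \<open>closed S\<close> SO by (intro holomorphic_on_imp_continuous_on holomorphic_on_subset[OF g_hol]) simp
      show "0 \<in> S" using False z0 \<delta> by (simp add: S_def d_def h0)
      fix \<zeta> assume "\<zeta> \<in> frontier S"
      then have \<zeta>: "\<zeta> \<in> S" "\<zeta> \<notin> interior S" using \<open>closed S\<close> by (auto simp: frontier_def)
      have "d \<zeta> \<le> \<delta> / 2"
      proof (rule ccontr)
        assume "\<not> d \<zeta> \<le> \<delta> / 2"
        then have "\<zeta> \<in> {\<zeta>. h \<zeta> \<in> \<Omega>} \<inter> {\<zeta>. \<delta> / 2 < d \<zeta>}" using \<zeta> SO by auto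
        moreover have "open ({\<zeta>. h \<zeta> \<in> \<Omega>} \<inter> {\<zeta>. \<delta> / 2 < d \<zeta>})"
          by (intro open_Int hopen open_Collect_less contd continuous_on_const)
        moreover have "{\<zeta>. h \<zeta> \<in> \<Omega>} \<inter> {\<zeta>. \<delta> / 2 < d \<zeta>} \<subseteq> S" by (auto simp: S_def)
        ultimately show False using \<zeta>(2) interiorI by blast
      qed
      then have "norm (\<Phi> (h \<zeta>) *v u) \<le> r * norm u"
        using near[of "h \<zeta>"] \<zeta>(1) SO \<delta> hj by (auto simp: d_def)
      then have "cmod (hprod (\<Phi> (h \<zeta>) *v u) v) \<le> r * norm u * norm v"
        by (meson cmod_hprod_le mult_right_mono norm_ge_zero order_trans)
      then show "cmod (g \<zeta>) \<le> cmod ?c * (r * norm u * norm v)"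
        using \<zeta>(1) SO by (subst g_eq) (auto simp: norm_mult intro: mult_left_mono)
    qed (rule \<open>bounded S\<close>)
    moreover have "cmod (g 0) = cmod ?c * (norm v * norm v)"
      using g_eq[of 0] z0 by (simp add: h0 v_def[symmetric] hprod_self norm_mult power2_eq_square)
    ultimately have "norm v * norm v \<le> r * norm u * norm v" using nz by simp
    then show ?thesis
      using r(1) unfolding v_def[symmetric] by (cases "norm v = 0") auto
  qed
  with r(2) show "norm (\<Phi> z0 *v u) \<le> norm u + e" by linarith
qed

text \<open>Near \<open>a\<close>, and along any complex line through \<open>a\<close>, the holomorphic function
  \<open>hprod (\<Phi> z *v u) (\<Phi> a *v u)\<close> has modulus at most \<open>(norm u)\<^sup>2\<close> and attains this value at \<open>a\<close>, so
  it is constant.  Equality in the Cauchy-Schwarz inequality then gives \<open>\<Phi> z *v u = \<Phi> a *v u\<close>.\<close>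

lemma multiplier_constant:
  assumes conn: "connected \<Omega>" and Z: "finite Z"
    and cover: "\<And>z. z \<in> \<Omega> - Z \<Longrightarrow> \<exists>j. poly (p j) (z $ j) \<noteq> 0"
    and iso: "\<And>z u. z \<in> \<Omega> - Z \<Longrightarrow> norm (\<Phi> z *v u) = norm u"
  shows "\<exists>W. \<forall>z\<in>\<Omega> - Z. \<Phi> z = W"
proof -
  have "open (\<Omega> - Z)" using open_domain Z by (simp add: open_Diff finite_imp_closed)
  have "connected (\<Omega> - Z)"
    using open_domain conn Z by (intro connected_open_delete_finite) (simp_all add: DIM_cart)
  moreover have "\<exists>N. openin (top_of_set (\<Omega> - Z)) N \<and> a \<in> N \<and> (\<forall>x\<in>N. \<Phi> x = \<Phi> a)" if a: "a \<in> \<Omega> - Z" for a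
  proof -
    obtain j where j: "poly (p j) (a $ j) \<noteq> 0" using cover[OF a] by blast
    have "open ((\<Omega> - Z) \<inter> {z. poly (p j) (z $ j) \<noteq> 0})"
      using \<open>open (\<Omega> - Z)\<close> by (intro open_Int open_Collect_neq) (auto intro!: continuous_intros)
    then obtain r where r: "r > 0" "ball a r \<subseteq> (\<Omega> - Z) \<inter> {z. poly (p j) (z $ j) \<noteq> 0}"
      using a j by (metis (mono_tags, lifting) IntI mem_Collect_eq open_contains_ball)
    have "\<Phi> b *v u = \<Phi> a *v u" if b: "b \<in> ball a r" for b u
    proof (cases "b = a")
      case False
      define h where "h \<zeta> = a + \<zeta> *s (b - a)" for \<zeta> :: complex
      \<comment> \<open>the parameters for which the line stays in the ball; \<open>0\<close> gives \<open>a\<close> and \<open>1\<close> gives \<open>b\<close>\<close>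
      define D where "D = ball (0 :: complex) (r / norm (b - a))"
      have h: "h \<zeta> \<in> ball a r" if "\<zeta> \<in> D" for \<zeta>
      proof -
        have "dist a (h \<zeta>) = norm (\<zeta> *s (b - a))"
          by (subst dist_commute) (simp only: h_def dist_norm add_diff_cancel_left')
        then show ?thesis using that False unfolding norm_scale_vec by (simp add: D_def field_simps)
      qed
      have hO: "h \<zeta> \<in> \<Omega> - Z" "poly (p j) (h \<zeta> $ j) \<noteq> 0" if "\<zeta> \<in> D" for \<zeta>
        using h[OF that] r(2) by auto
      define v where "v = \<Phi> a *v u"
      have nv: "norm v = norm u" using iso[OF a] by (simp add: v_def)
      define g where "g \<zeta> = hprod (U (test_fun j u) (h \<zeta>)) v / poly (p j) (h \<zeta> $ j)" for \<zeta>
      have g_eq: "g \<zeta> = hprod (\<Phi> (h \<zeta>) *v u) v" if "\<zeta> \<in> D" for \<zeta>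
        unfolding g_def using U_test_fun[of "h \<zeta>" j u] hO[OF that] by (simp add: hprod_scale_left)
      have 01: "0 \<in> D" "1 \<in> D" using r(1) b False by (auto simp: D_def dist_norm norm_minus_commute)
      have g0: "g 0 = of_real ((norm u)\<^sup>2)"
        using g_eq[OF 01(1)] hprod_self[of v] nv by (simp add: h_def v_def)
      have "g constant_on D"
      proof (rule maximum_modulus_principle[where U = D and \<xi> = 0])
        have "(\<lambda>\<zeta>. hprod (U (test_fun j u) (h \<zeta>)) v) holomorphic_on D"
          unfolding h_def
          by (rule holomorphic_on_subset[OF U_holomorphic_on_line[OF test_fun_mem]])
            (use hO in \<open>auto simp: h_def\<close>)
        moreover have "(\<lambda>\<zeta>. poly (p j) (h \<zeta> $ j)) holomorphic_on D"
          unfolding h_def by (auto intro!: holomorphic_intros)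
        ultimately show "g holomorphic_on D"
          unfolding g_def using hO(2) by (intro holomorphic_on_divide) auto
        fix \<zeta> assume \<zeta>: "\<zeta> \<in> D"
        have "cmod (g \<zeta>) \<le> norm u * norm u"
          using cmod_hprod_le[of "\<Phi> (h \<zeta>) *v u" v] iso[OF hO(1)[OF \<zeta>]] g_eq[OF \<zeta>] nv by simp
        then show "cmod (g \<zeta>) \<le> cmod (g 0)" by (simp add: g0 power2_eq_square norm_mult)
      qed (use 01 in \<open>auto simp: D_def\<close>)
      then have "g 1 = g 0" using 01 by (auto simp: constant_on_def)
      then have "hprod (\<Phi> b *v u) v = of_real ((norm u)\<^sup>2)"
        using g_eq[OF 01(2)] g0 by (simp add: h_def)
      then have "inner (\<Phi> b *v u) v = (norm u)\<^sup>2"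
        using Re_hprod[of "\<Phi> b *v u" v] by (simp del: of_real_power)
      moreover have "norm (\<Phi> b *v u) = norm u" using iso b r(2) by blast
      ultimately have "(norm (\<Phi> b *v u - v))\<^sup>2 = 0"
        using nv dot_norm_neg[of "\<Phi> b *v u" v] by simp
      then show ?thesis by (simp add: v_def)
    qed simp
    then have "\<Phi> b = \<Phi> a" if "b \<in> ball a r" for b using that by (simp add: matrix_eq)
    moreover have "openin (top_of_set (\<Omega> - Z)) (ball a r)"
      using r(2) by (intro open_subset) auto
    moreover have "a \<in> ball a r" using r(1) by simp
    ultimately show ?thesis by blast
  qed
  ultimately have "\<Phi> constant_on (\<Omega> - Z)" by (rule locally_constant_imp_constant)
  then show ?thesis by (auto simp: constant_on_def)
qed

end

section \<open>Unitary equivalence of submodules\<close>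

text \<open>By polarisation: the norm determines the real inner product, and the latter determines
  the Hermitian one, whose imaginary part is the real inner product with \<open>\<i> *s v\<close>.\<close>

lemma unitary_matrix_of_isometry:
  fixes W :: "complex ^ 'n ^ 'n"
  assumes iso: "\<And>u. norm (W *v u) = norm u"
  shows "unitary_matrix W"
proof -
  have inner: "inner (W *v u) (W *v v) = inner u v" for u v
    using iso by (simp add: dot_norm matrix_vector_right_distrib[symmetric])
  have Im: "Im (hprod u v) = inner u (\<i> *s v)" for u v :: "complex ^ 'n"
    by (simp add: hprod_def inner_vec_def inner_complex_def algebra_simps)
  have hprod: "hprod (W *v u) (W *v v) = hprod u v" for u v
    by (rule complex_eqI) (simp_all add: Re_hprod Im inner vector_scalar_commute[symmetric])
  have "(conj_transpose W ** W) $ i $ j = mat 1 $ i $ j" for i j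
  proof -
    have column: "(W *v axis j 1) $ k = W $ k $ j" for j k
      by (simp add: matrix_vector_mult_def axis_def if_distrib[of "(*) _"] cong: if_cong)
    have "(conj_transpose W ** W) $ i $ j = hprod (W *v axis j 1) (W *v axis i 1)"
      by (simp add: conj_transpose_def matrix_matrix_mult_def hprod_def column mult.commute)
    also have "\<dots> = hprod (axis j 1) (axis i 1)" by (rule hprod)
    also have "\<dots> = (\<Sum>k\<in>UNIV. if k = j then (if k = i then 1 else 0) else 0)"
      unfolding hprod_def by (intro sum.cong) (auto simp: axis_def)
    also have "\<dots> = mat 1 $ i $ j" by (auto simp: mat_def)
    finally show ?thesis .
  qed
  then have "conj_transpose W ** W = mat 1" by (simp add: vec_eq_iff)
  then show ?thesis unfolding unitary_matrix_def using matrix_left_right_inverse by blast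
qed

lemma unitary_module_iso_inv:
  assumes U: "unitary_module_iso ip M1 M2 U"
    and M1: "vfun.subspace M1" "\<And>j. coord_mult_tensor j ` M1 \<subseteq> M1"
  shows "unitary_module_iso ip M2 M1 (inv_into M1 U)"
proof -
  have bij: "bij_betw U M1 M2" using U by (simp add: unitary_module_iso_def)
  then have M2: "M2 = U ` M1" by (simp add: bij_betw_def)
  have inv: "inv_into M1 U (U F) = F" if "F \<in> M1" for F
    using bij that by (simp add: bij_betw_inv_into_left)
  note Ux = U[unfolded unitary_module_iso_def]
  have "inv_into M1 U (U F + U G) = F + G" if "F \<in> M1" "G \<in> M1" for F G
    using Ux inv[OF vfun.subspace_add[OF M1(1) that]] that by metis
  moreover have "inv_into M1 U (vscale c (U F)) = vscale c F" if "F \<in> M1" for F c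
    using Ux inv[OF vfun.subspace_scale[OF M1(1) that]] that by metis
  moreover have "inv_into M1 U (coord_mult_tensor j (U F)) = coord_mult_tensor j F" if "F \<in> M1" for F j
  proof -
    have "coord_mult_tensor j F \<in> M1" using M1(2) that by blast
    from inv[OF this] show ?thesis using Ux that by metis
  qed
  ultimately show ?thesis
    using Ux bij_betw_inv_into[OF bij] unfolding unitary_module_iso_def M2 by (simp add: inv)
qed

lemma eventually_in_cofinite_open:
  fixes \<Omega> :: "'a::t1_space set"
  assumes "open \<Omega>" "finite Z" "z \<in> \<Omega>"
  shows "eventually (\<lambda>x. x \<in> \<Omega> - Z) (at z)"
proof -
  have "eventually (\<lambda>x. x \<notin> Z) (at z)"
    using islimpt_finite[OF assms(2)] by (auto simp: islimpt_iff_eventually)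
  with eventually_at_in_open'[OF assms(1,3)] show ?thesis by eventually_elim simp
qed

lemma (in module_embedding) T_continuous:
  assumes F: "F \<in> T" and z: "z \<in> \<Omega>"
  shows "(F \<longlongrightarrow> F z) (at z)"
proof (rule vec_tendstoI)
  fix i
  obtain D where "((\<lambda>z. F z $ i) has_derivative D) (at z)"
    using holomorphic[OF component_mem[OF F, of i]] z unfolding holomorphic_Cn_on_def by blast
  then show "((\<lambda>x. F x $ i) \<longlongrightarrow> F z $ i) (at z)"
    using has_derivative_continuous continuous_at by blast
qed

theorem theorem1p5:
  fixes \<Omega> :: "(complex ^ 'd) set"
    and H :: "(complex ^ 'd \<Rightarrow> complex) set"
    and ip :: "(complex ^ 'd \<Rightarrow> complex) \<Rightarrow> (complex ^ 'd \<Rightarrow> complex) \<Rightarrow> complex"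
    and \<KK> :: "complex ^ 'd \<Rightarrow> complex ^ 'd \<Rightarrow> complex"
    and M1 M2 :: "(complex ^ 'd \<Rightarrow> complex ^ 'n) set"
  assumes "CARD('d) \<ge> 2"
    and "open \<Omega>" and "connected \<Omega>" and "\<Omega> \<noteq> {}" and "bounded \<Omega>"
    and "holomorphic_rkhs \<Omega> H ip \<KK>"
    and "polynomials \<Omega> \<subseteq> H"
    and "ip_topology H ip closure_of polynomials \<Omega> = H"
    and "\<And>j. bounded_on H ip (coord_mult j)"
    and "tends_to_infinity_at_boundary \<Omega> (\<lambda>z. Re (\<KK> z z))"
    and "submodule H ip M1" and "finite_codim H M1"
    and "submodule H ip M2" and "finite_codim H M2"
  shows "((\<exists>U. unitary_module_iso ip M1 M2 U) \<longrightarrow>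
            (\<exists>W. unitary_matrix W \<and> M2 = matrix_tensor W ` M1)) \<and>
         (CARD('n) = 1 \<longrightarrow> ((\<exists>U. unitary_module_iso ip M1 M2 U) \<longleftrightarrow> M1 = M2))"
proof -
  have M1: "vfun.subspace M1" "\<And>j. coord_mult_tensor j ` M1 \<subseteq> M1"
    and M2: "vfun.subspace M2"
    using assms(11,13) by (auto simp: submodule_def)
  have embedding: "module_embedding \<Omega> H ip \<KK> N U"
    if "submodule H ip N" "finite_codim H N" "unitary_module_iso ip N N' U" "finite_codim H N'"
    for N N' :: "(complex ^ 'd \<Rightarrow> complex ^ 'n) set" and U
  proof (rule module_embedding.intro[OF assms(6)], unfold_locales)
    note U = that(3)[unfolded unitary_module_iso_def]
    have "U ` N = N'" "N' \<subseteq> tensor_Cn H"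
      using U that(4) by (auto simp: bij_betw_def finite_codim_def)
    then show "U F \<in> tensor_Cn H" if "F \<in> N" for F using that by blast
    show "U (F + G) = U F + U G" if "F \<in> N" "G \<in> N" for F G using U that by blast
    show "U (vscale c F) = vscale c (U F)" if "F \<in> N" for F c using U that by blast
    show "tensor_ip ip (U F) (U G) = tensor_ip ip F G" if "F \<in> N" "G \<in> N" for F G using U that by blast
    show "U (coord_mult_tensor j F) = coord_mult_tensor j (U F)" if "F \<in> N" for F j using U that by blast
  qed (use assms that in auto)
  have main: "\<exists>W. unitary_matrix W \<and> M2 = matrix_tensor W ` M1" if U: "unitary_module_iso ip M1 M2 U" for U
  proof -
    define U' where "U' = inv_into M1 U"
    have bij: "bij_betw U M1 M2" using U by (simp add: unitary_module_iso_def)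
    have U': "unitary_module_iso ip M2 M1 U'"
      unfolding U'_def by (rule unitary_module_iso_inv[OF U M1])
    interpret E: module_embedding \<Omega> H ip \<KK> M1 U by (rule embedding[OF assms(11,12) U assms(14)])
    interpret E': module_embedding \<Omega> H ip \<KK> M2 U' by (rule embedding[OF assms(13,14) U' assms(12)])
    obtain p \<Phi> where p: "\<And>j. p j \<noteq> 0" "\<And>j F. F \<in> tensor_Cn H \<Longrightarrow> poly_mult j (p j) F \<in> M1"
      "\<And>z j F. z \<in> \<Omega> \<Longrightarrow> poly (p j) (z $ j) \<noteq> 0 \<Longrightarrow> F \<in> M1 \<Longrightarrow> U F z = \<Phi> z *v F z"
      by (rule E.exists_multiplier) blast
    obtain q \<Psi> where q: "\<And>j. q j \<noteq> 0" "\<And>j F. F \<in> tensor_Cn H \<Longrightarrow> poly_mult j (q j) F \<in> M2"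
      "\<And>z j F. z \<in> \<Omega> \<Longrightarrow> poly (q j) (z $ j) \<noteq> 0 \<Longrightarrow> F \<in> M2 \<Longrightarrow> U' F z = \<Psi> z *v F z"
      by (rule E'.exists_multiplier) blast
    interpret A: module_multiplier \<Omega> H ip \<KK> M1 U p \<Phi>
      by unfold_locales (use p in auto)
    interpret B: module_multiplier \<Omega> H ip \<KK> M2 U' q \<Psi>
      by unfold_locales (use q in auto)
    define Z where "Z = {z. \<forall>j. poly (p j) (z $ j) = 0} \<union> {z. \<forall>j. poly (q j) (z $ j) = 0}"
    have Z: "finite Z" unfolding Z_def by (intro finite_UnI finite_common_zeros p q)
    have coverp: "\<exists>j. poly (p j) (z $ j) \<noteq> 0" and coverq: "\<exists>j. poly (q j) (z $ j) \<noteq> 0"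
      if "z \<in> \<Omega> - Z" for z using that by (auto simp: Z_def)
    have iso: "norm (\<Phi> z *v u) = norm u" if z: "z \<in> \<Omega> - Z" for z u
    proof -
      obtain j where j: "poly (p j) (z $ j) \<noteq> 0" using coverp[OF z] by blast
      obtain k where k: "poly (q k) (z $ k) \<noteq> 0" using coverq[OF z] by blast
      let ?F = "A.test_fun j u" and ?c = "poly (p j) (z $ j)"
      have F: "?F \<in> M1" by (rule A.test_fun_mem)
      have UF: "U ?F \<in> M2" using bij_betwE[OF bij] F by blast
      have "?F z = U' (U ?F) z" unfolding U'_def bij_betw_inv_into_left[OF bij F] ..
      also have "\<dots> = \<Psi> z *v (?c *s (\<Phi> z *v u))"
        using q(3)[OF _ k UF] A.U_test_fun[of z j u] z j by simp
      \<comment> \<open>\<open>\<Psi> z\<close> is a left inverse of \<open>\<Phi> z\<close>, since \<open>test_fun j u\<close> takes the value \<open>?c *s u\<close> at \<open>z\<close>\<close>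
      finally have "?c *s (\<Psi> z *v (\<Phi> z *v u)) = ?c *s u"
        using A.test_fun_apply[of z j u] z by (simp add: vector_scalar_commute)
      then have "\<Psi> z *v (\<Phi> z *v u) = u" using j by simp
      then have "norm u \<le> norm (\<Phi> z *v u)"
        using B.multiplier_contraction[of z k "\<Phi> z *v u"] z k by simp
      moreover have "norm (\<Phi> z *v u) \<le> norm u"
        using A.multiplier_contraction[of z j u] z j by simp
      ultimately show ?thesis by simp
    qed
    obtain W where W: "\<And>z. z \<in> \<Omega> - Z \<Longrightarrow> \<Phi> z = W"
      using A.multiplier_constant[OF assms(3) Z coverp iso] by blast
    obtain z0 where "z0 \<in> \<Omega>" using assms(4) by blast
    then have "\<exists>z. z \<in> \<Omega> - Z"
      using eventually_happens[OF eventually_in_cofinite_open[OF assms(2) Z]] by auto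
    then have "norm (W *v u) = norm u" for u using iso W by metis
    then have "unitary_matrix W" by (rule unitary_matrix_of_isometry)
    \<comment> \<open>off the finite set \<open>Z\<close> this is the definition of \<open>W\<close>; on \<open>Z\<close> it follows by continuity\<close>
    moreover have U_eq: "U F = matrix_tensor W F" if F: "F \<in> M1" for F
    proof
      fix z
      have FT: "F \<in> tensor_Cn H" using F E.M_sub by blast
      show "U F z = matrix_tensor W F z"
      proof (cases "z \<in> \<Omega>")
        case False
        then show ?thesis
          using E.T_outside[OF FT] E.T_outside[OF E.U_mem[OF F]] by (simp add: matrix_tensor_def)
      next
        case True
        have "((\<lambda>x. W *v F x) \<longlongrightarrow> W *v F z) (at z)"
          by (rule bounded_linear.tendsto[OF matrix_vector_mul_bounded_linear E.T_continuous[OF FT True]])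
        moreover have "eventually (\<lambda>x. W *v F x = U F x) (at z)"
          using eventually_in_cofinite_open[OF assms(2) Z True]
        proof eventually_elim
          case (elim x)
          then show ?case using coverp[OF elim] p(3)[OF _ _ F] W[OF elim] by auto
        qed
        ultimately have "(U F \<longlongrightarrow> W *v F z) (at z)" by (rule Lim_transform_eventually)
        then show ?thesis
          using tendsto_unique[OF _ E.T_continuous[OF E.U_mem[OF F] True]] by (simp add: matrix_tensor_def)
      qed
    qed
    moreover have "M2 = matrix_tensor W ` M1"
      using bij U_eq by (auto simp: bij_betw_def image_def)
    ultimately show ?thesis by blast
  qed
  have "M1 = M2" if card: "CARD('n) = 1" and iso: "unitary_module_iso ip M1 M2 U" for U
  proof -
    obtain W where W: "unitary_matrix W" "M2 = matrix_tensor W ` M1" using main[OF iso] by blast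
    obtain i where i: "UNIV = {i :: 'n}" using card by (auto simp: card_1_singleton_iff)
    then have all: "k = i" for k by blast
    define c where "c = W $ i $ i"
    have WF: "matrix_tensor W F = vscale c F" for F :: "complex ^ 'd \<Rightarrow> complex ^ 'n"
    proof -
      have "(W *v F z) $ k = c * F z $ k" for z k
        unfolding all[of k] by (simp add: matrix_vector_mult_def i c_def)
      then show ?thesis by (simp add: matrix_tensor_def vscale_def fun_eq_iff vec_eq_iff)
    qed
    have "c \<noteq> 0"
    proof
      assume "c = 0"
      have "(conj_transpose W ** W) $ i $ i = 0"
        using \<open>c = 0\<close> by (simp add: matrix_matrix_mult_def i c_def)
      then show False using W(1) by (simp add: unitary_matrix_def mat_def)
    qed
    have "F \<in> M2" if "F \<in> M1" for F
    proof -
      have "vscale (1 / c) F \<in> M1" using M1(1) that by (rule vfun.subspace_scale)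
      then have "matrix_tensor W (vscale (1 / c) F) \<in> M2" using W(2) by blast
      then show ?thesis using \<open>c \<noteq> 0\<close> by (simp add: WF)
    qed
    moreover have "M2 \<subseteq> M1" using W(2) WF vfun.subspace_scale[OF M1(1)] by auto
    ultimately show ?thesis by blast
  qed
  moreover have "unitary_module_iso ip M1 M1 id"
    by (simp add: unitary_module_iso_def)
  ultimately show ?thesis using main by metis
qed

end
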